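(* Let $a,b,c,d$ be integers, and set $u=a+c$, $v=b+d$. Assume $a\neq 0$, $c\neq 0$ and $u\neq 0$. Then, as operators on $\Lambda$, $$\frac{1}{M}\big(D_{c,d}D_{a,b}-D_{a,b}D_{c,d}\big)\;=\;q^{1+bc}\,\frac{[a]_q[c]_q}{[u]_q}\,\frac{1-q^{da-bc}}{1-q}\,D_{u,v}.$$
   Context: Let $\Lambda$ be the ring of symmetric functions in the infinite alphabet $X=x_1+x_2+\cdots$ with coefficients in $\mathbb{Q}(q)$. Plethystic notation: for a formal expression $E$ (in the $x_i$, $q$, an auxiliary variable $z$, etc.), $p_k[E]$ is obtained from $E$ by replacing every variable (including $q$ and $z$) by its $k$-th power; for $F\in\Lambda$, $F[E]$ is obtained by writing $F$ as a polynomial in the power sums $p_k$ and substituting $p_k\mapsto p_k[E]$. Set $\Omega[E]=\exp\big(\sum_{k\ge1}p_k[E]/k\big)$, so that $\Omega[-zX]=\sum_{r\ge0}(-z)^re_r[X]$. For an integer $u$ put $[u]_q=(1-q^u)/(1-q)$ (so $[u]_q=1+q+\cdots+q^{u-1}$ for $u\ge0$). Throughout set $t=1/q$, $[u]_t=(1-q^{-u})/(1-q^{-1})$ and $M=(1-t)(1-q)=(1-q^{-1})(1-q)$. For integers $u,v$, $D_{u,v}$ is the linear operator on $\Lambda$ defined by $$D_{u,v}F[X]=F\big[X+M[u]_q/z\big]\;\Omega\big[-z[u]_tX\big]\Big|_{z^v},$$ where the product is expanded as a series in $z$ (with finitely many negative powers of $z$ in each homogeneous component) and $|_{z^v}$ denotes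 the coefficient of $z^v$. *)

theory Defs
  imports
    "HOL-Library.Multiset"
    "HOL-Library.Poly_Mapping"
    "HOL-Computational_Algebra.Computational_Algebra"
begin

type_synonym qrat = "rat poly fract"

definition qvar :: qrat where
  "qvar = Fract [:0, 1:] 1"

definition tvar :: qrat where
  "tvar = 1 / qvar"

definition qint :: "qrat \<Rightarrow> int \<Rightarrow> qrat" where
  "qint x u = (1 - x powi u) / (1 - x)"

definition Mq :: qrat where
  "Mq = (1 - tvar) * (1 - qvar)"

text \<open>The substitution that replaces \<open>q\<close> by \<open>q^k\<close>; only \<open>k \<ge> 1\<close> is meaningful.\<close>

definition qrat_subst :: "nat \<Rightarrow> qrat \<Rightarrow> qrat" where
  "qrat_subst k c =
     (THE r. \<forall>a b. b \<noteq> 0 \<longrightarrow> c = Fract a b \<longrightarrow>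
        r = Fract (pcompose a (monom 1 k)) (pcompose b (monom 1 k)))"

lemma qrat_subst_Fract:
  assumes "k > 0" and "b \<noteq> 0"
  shows "qrat_subst k (Fract a b) = Fract (pcompose a (monom 1 k)) (pcompose b (monom 1 k))"
proof -
  have nz: "pcompose p (monom 1 k) \<noteq> 0" if "p \<noteq> 0" for p :: "rat poly"
    using that assms(1) by (auto simp: pcompose_eq_0_iff degree_monom_eq)
  have "Fract (pcompose a (monom 1 k)) (pcompose b (monom 1 k)) =
        Fract (pcompose a' (monom 1 k)) (pcompose b' (monom 1 k))"
    if "b' \<noteq> 0" "Fract a b = Fract a' b'" for a' b'
    using that assms(2) nz by (simp add: eq_fract flip: pcompose_mult)
  thus ?thesis
    unfolding qrat_subst_def using assms(2) by (intro the_equality) blast+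
qed

text \<open>
  A monomial in the variables \<open>x\<^sub>0, x\<^sub>1, \<dots>\<close> is a finite multiset of variable indices.
\<close>

typedef 'a mps = "UNIV :: (nat multiset \<Rightarrow> 'a) set"
  morphisms mps_coeff Abs_mps ..

setup_lifting type_definition_mps

lemma mps_eqI: "(\<And>m. mps_coeff f m = mps_coeff g m) \<Longrightarrow> f = g"
  by transfer (rule ext)

instantiation mps :: (zero) zero
begin
lift_definition zero_mps :: "'a mps" is "\<lambda>_. 0" .
instance ..
end

instantiation mps :: ("{zero,one}") one
begin
lift_definition one_mps :: "'a mps" is "\<lambda>m. if m = {#} then 1 else 0" .
instance ..
end

instantiation mps :: (plus) plus
begin
lift_definition plus_mps :: "'a mps \<Rightarrow> 'a mps \<Rightarrow> 'a mps" is "\<lambda>f g m. f m + g m" .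
instance ..
end

instantiation mps :: (minus) minus
begin
lift_definition minus_mps :: "'a mps \<Rightarrow> 'a mps \<Rightarrow> 'a mps" is "\<lambda>f g m. f m - g m" .
instance ..
end

instantiation mps :: (uminus) uminus
begin
lift_definition uminus_mps :: "'a mps \<Rightarrow> 'a mps" is "\<lambda>f m. - f m" .
instance ..
end

instantiation mps :: ("{comm_monoid_add,times}") times
begin
lift_definition times_mps :: "'a mps \<Rightarrow> 'a mps \<Rightarrow> 'a mps"
  is "\<lambda>f g m. \<Sum>a | a \<subseteq># m. f a * g (m - a)" .
instance ..
end

lemma finite_submultisets: "finite {a :: nat multiset. a \<subseteq># m}"
proof -
  have "{a. a \<subseteq># m} \<subseteq> mset ` {xs. set xs \<subseteq> set_mset m \<and> length xs \<le> size m}"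
  proof
    fix a assume "a \<in> {a. a \<subseteq># m}"
    hence a: "a \<subseteq># m" by simp
    obtain xs where xs: "mset xs = a" using ex_mset by blast
    have "set xs \<subseteq> set_mset m" using a xs set_mset_mono[OF a] by auto
    moreover have "length xs \<le> size m" using size_mset_mono[OF a] xs by (metis size_mset)
    ultimately show "a \<in> mset ` {xs. set xs \<subseteq> set_mset m \<and> length xs \<le> size m}"
      using xs by auto
  qed
  thus ?thesis
    by (rule finite_subset) (intro finite_imageI finite_lists_length_le; simp)
qed

instance mps :: (comm_ring_1) comm_ring_1
proof
  fix f g h :: "'a mps"
  show "f + g + h = f + (g + h)" by transfer (simp add: add.assoc)
  show "f + g = g + f" by transfer (simp add: add.commute)
  show "0 + f = f" by transfer simp
  show "- f + f = 0" by transfer simp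
  show "f - g = f + - g" by transfer simp
  show "(0 :: 'a mps) \<noteq> 1" by transfer (auto simp: fun_eq_iff)
  show "(f + g) * h = f * h + g * h"
    by transfer (simp add: algebra_simps sum.distrib)
  show "f * g = g * f"
  proof (transfer, rule ext)
    fix f g :: "nat multiset \<Rightarrow> 'a" and m
    show "(\<Sum>a | a \<subseteq># m. f a * g (m - a)) = (\<Sum>a | a \<subseteq># m. g a * f (m - a))"
      by (rule sum.reindex_bij_witness[where i = "\<lambda>a. m - a" and j = "\<lambda>a. m - a"])
         (auto simp: mult.commute subset_mset.diff_diff_right)
  qed
  show "1 * f = f"
  proof (transfer, rule ext)
    fix f :: "nat multiset \<Rightarrow> 'a" and m
    have "(\<Sum>a | a \<subseteq># m. (if a = {#} then 1 else 0) * f (m - a))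
        = (\<Sum>a\<in>{{#}}. (if a = {#} then 1 else 0) * f (m - a))"
      by (rule sum.mono_neutral_right) (auto simp: finite_submultisets)
    thus "(\<Sum>a | a \<subseteq># m. (if a = {#} then 1 else 0) * f (m - a)) = f m" by simp
  qed
  show "f * g * h = f * (g * h)"
  proof (transfer, rule ext)
    fix f g h :: "nat multiset \<Rightarrow> 'a" and m
    have "(\<Sum>a | a \<subseteq># m. (\<Sum>b | b \<subseteq># a. f b * g (a - b)) * h (m - a))
        = (\<Sum>(a, b) \<in> (SIGMA a:{a. a \<subseteq># m}. {b. b \<subseteq># a}). f b * g (a - b) * h (m - a))"
      by (subst sum.Sigma[symmetric]) (auto simp: finite_submultisets sum_distrib_right)
    also have "\<dots> = (\<Sum>(b, c) \<in> (SIGMA b:{b. b \<subseteq># m}. {c. c \<subseteq># m - b}).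
                       f b * (g c * h (m - b - c)))"
      by (rule sum.reindex_bij_witness[where i = "\<lambda>(b, c). (b + c, b)"
                                         and j = "\<lambda>(a, b). (b, a - b)"])
         (auto simp: mult.assoc subset_mset.le_diff_conv2 add.commute diff_diff_add_mset
               intro: subset_mset.order_trans)
    also have "\<dots> = (\<Sum>b | b \<subseteq># m. f b * (\<Sum>c | c \<subseteq># m - b. g c * h (m - b - c)))"
      by (subst sum.Sigma[symmetric]) (auto simp: finite_submultisets sum_distrib_left)
    finally show "(\<Sum>a | a \<subseteq># m. (\<Sum>b | b \<subseteq># a. f b * g (a - b)) * h (m - a))
        = (\<Sum>b | b \<subseteq># m. f b * (\<Sum>c | c \<subseteq># m - b. g c * h (m - b - c)))" .
  qed
qed

lift_definition mps_const :: "'a :: zero \<Rightarrow> 'a mps" is "\<lambda>c m. if m = {#} then c else 0" .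

definition Sym :: "qrat mps set" where
  "Sym = {F. (\<forall>\<pi> m. bij \<pi> \<longrightarrow> mps_coeff F (image_mset \<pi> m) = mps_coeff F m)
           \<and> (\<exists>N. \<forall>m. mps_coeff F m \<noteq> 0 \<longrightarrow> size m \<le> N)}"

definition power_sum :: "nat \<Rightarrow> qrat mps" where
  "power_sum k = Abs_mps (\<lambda>m. if \<exists>i. m = replicate_mset k i then 1 else 0)"

text \<open>
  Polynomials in indeterminates \<open>p\<^sub>1, p\<^sub>2, \<dots>\<close> over Q(q) are finitely supported functions on
  partitions, i.e. on multisets of positive integers; \<open>eval_ppoly h \<phi> P\<close> substitutes \<open>\<phi> k\<close> for
  \<open>p\<^sub>k\<close> and maps scalars by \<open>h\<close>.
\<close>

type_synonym ppoly = "nat multiset \<Rightarrow>\<^sub>0 qrat"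

definition eval_ppoly :: "(qrat \<Rightarrow> 'r) \<Rightarrow> (nat \<Rightarrow> 'r) \<Rightarrow> ppoly \<Rightarrow> 'r :: comm_ring_1" where
  "eval_ppoly h \<phi> P =
     (\<Sum>\<mu> \<in> Poly_Mapping.keys P. h (Poly_Mapping.lookup P \<mu>) * (\<Prod>k\<in>#\<mu>. \<phi> k))"

text \<open>
  The description below is well defined on \<open>Sym\<close>: over a field of characteristic 0 the power sums
  are algebraically independent and generate the ring of symmetric functions.
\<close>

definition in_power_sums :: "qrat mps \<Rightarrow> ppoly" where
  "in_power_sums F =
     (THE P. (\<forall>\<mu> \<in> Poly_Mapping.keys P. 0 \<notin># \<mu>) \<and> eval_ppoly mps_const power_sum P = F)"

text \<open>
  Plethystic expressions live in the ring of Laurent series in \<open>z\<close> whose coefficients are power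
  series in the \<open>x\<^sub>i\<close> over Q(q).
\<close>

type_synonym expr = "qrat mps fls"

abbreviation scal :: "qrat \<Rightarrow> expr" where
  "scal c \<equiv> fls_const (mps_const c)"

abbreviation XX :: expr where
  "XX \<equiv> fls_const (power_sum 1)"

text \<open>
  \<open>p\<^sub>k[E]\<close> for \<open>k \<ge> 1\<close>: the variable \<open>q\<close> (in the coefficients), the variables \<open>x\<^sub>i\<close>, and the
  variable \<open>z\<close> are replaced by their \<open>k\<close>-th powers. The sum below has at most one term.
\<close>

definition pk_coeff :: "nat \<Rightarrow> qrat mps \<Rightarrow> qrat mps" where
  "pk_coeff k f = Abs_mps (\<lambda>m. \<Sum>n | repeat_mset k n = m. qrat_subst k (mps_coeff f n))"

definition pk :: "nat \<Rightarrow> expr \<Rightarrow> expr" where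
  "pk k E = fls_compose_power (Abs_fls (\<lambda>n. pk_coeff k (fls_nth E n))) k"

text \<open>In \<open>F[E]\<close> only the power sums are substituted; the scalar coefficients of \<open>F\<close> are left alone.\<close>

definition pleth :: "qrat mps \<Rightarrow> expr \<Rightarrow> expr" where
  "pleth F E = eval_ppoly scal (\<lambda>k. pk k E) (in_power_sums F)"

text \<open>
  The infinite sums are limits in the \<open>z\<close>-adic metric of the type of Laurent series; they converge
  for every \<open>E\<close> that involves only positive powers of \<open>z\<close>, since then \<open>p\<^sub>k[E]\<close> is divisible by \<open>z^k\<close>.
\<close>

definition fls_exp :: "expr \<Rightarrow> expr" where
  "fls_exp S = suminf (\<lambda>n. scal (1 / fact n) * S ^ n)"

definition Omega :: "expr \<Rightarrow> expr" where
  "Omega E = fls_exp (suminf (\<lambda>k. scal (1 / of_nat (Suc k)) * pk (Suc k) E))"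

definition D :: "int \<Rightarrow> int \<Rightarrow> qrat mps \<Rightarrow> qrat mps" where
  "D u v F =
     fls_nth (pleth F (XX + scal (Mq * qint qvar u) * fls_X_inv)
              * Omega (- (fls_X * scal (qint tvar u) * XX))) v"

end

(*
  Every D_{u,v} is determined by its value at 1, the coefficient of z^v in Omega[-z[u]_t X],
  and by the relation
    D_{u,v} (p_k F) = p_k D_{u,v} F + gamma_k(u) D_{u,v+k} F,
    gamma_k(u) = p_k[M[u]_q] = (1 - q^{-k})(1 - q^{ku}),
  because F is a polynomial in the power sums. Both sides of the commutator identity satisfy the
  same relation under F -> p_k F, so only F = 1 remains. There
    D_{c,d} h_b = sum_n f_n h_{b-n} h'_{d+n},
  where h and h' are the coefficients of Omega[-z[a]_t X] and Omega[-z[c]_t X], and f_n is the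
  coefficient of s^n in (1 - s)(1 - xys) / ((1 - xs)(1 - ys)) with x = q^{-a}, y = q^c. By partial
  fractions f_n = A (x^n - y^n) for n > 0. In D_{a,b} h'_d the numbers -A (x^n - y^n) with n < 0
  appear, so the difference is a sum over all integers n. It splits into two convolutions, each of
  which is evaluated with Omega[E] Omega[E'] = Omega[E + E'].
*)
theory Submission
  imports Defs "HOL-Combinatorics.Transposition"
begin

section \<open>Symmetric functions as polynomials in the power sums\<close>

text \<open>\<open>pleth\<close> reaches F only through the definite description
  \<open>in_power_sums\<close>, so nothing can be computed before the power sums are known to be
  algebraically independent and to generate the symmetric functions. Omega hides two nested infinite
  sums; the proof uses it only through its constant term 1 and a linear differential equation in z.
  Compared by coefficients, that equation is Newton's identity; combined with uniqueness of
  solutions, it yields the two required instances of Omega[E] Omega[E'] = Omega[E + E']. The kernel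
  arises because p_k[[a]_t] gamma_k(c) = (1 - x^k)(1 - y^k): its generating function is exp(- sum_k
  (1 - x^k)(1 - y^k) s^k / k), and expanding the product gives four logarithms, hence a rational
  function. That the two sides of the commutator identity obey the same relation under F -> p_k F is
  not formal: the scalar depends on b and d, which the relation shifts. It rests on (1 - Q)(PR - S)
  + (1 - P)(R - QS) = (R - S)(1 - PQ), where P = q^{ka}, Q = q^{kc}, R = q^{ad}, S = q^{bc}.\<close>

definition shape :: "nat multiset \<Rightarrow> nat multiset" where
  "shape m = image_mset (count m) (mset_set (set_mset m))"

definition psum_prod :: "nat multiset \<Rightarrow> qrat mps" where
  "psum_prod \<mu> = (\<Prod>k\<in>#\<mu>. power_sum k)"

section \<open>Coefficients of series and of products of power sums\<close>

lemma mps_coeff_zero [simp]: "mps_coeff 0 m = 0"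
  by transfer simp

lemma mps_coeff_one: "mps_coeff 1 m = (if m = {#} then 1 else 0)"
  by transfer simp

lemma mps_coeff_add [simp]: "mps_coeff (f + g) m = mps_coeff f m + mps_coeff g m"
  by transfer simp

lemma mps_coeff_diff [simp]: "mps_coeff (f - g) m = mps_coeff f m - mps_coeff g m"
  by transfer simp

lemma mps_coeff_sum: "mps_coeff (\<Sum>i\<in>A. f i) m = (\<Sum>i\<in>A. mps_coeff (f i) m)"
  for f :: "'b \<Rightarrow> 'a::comm_ring_1 mps"
  by (induction A rule: infinite_finite_induct) auto

lemma mps_coeff_times:
  "mps_coeff (f * g) m = (\<Sum>a | a \<subseteq># m. mps_coeff f a * mps_coeff g (m - a))"
  by transfer simp

lemma mps_coeff_const: "mps_coeff (mps_const c) m = (if m = {#} then c else 0)"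
  by transfer simp

lemma mps_coeff_const_times [simp]:
  fixes f :: "'a::comm_ring_1 mps"
  shows "mps_coeff (mps_const c * f) m = c * mps_coeff f m"
proof -
  have "mps_coeff (mps_const c * f) m = (\<Sum>a\<in>{{#}}. mps_coeff (mps_const c) a * mps_coeff f (m - a))"
    unfolding mps_coeff_times
    by (rule sum.mono_neutral_right) (auto simp: finite_submultisets mps_coeff_const)
  thus ?thesis by (simp add: mps_coeff_const)
qed

lemma mps_const_0 [simp]: "mps_const 0 = 0"
  by (rule mps_eqI) (simp add: mps_coeff_const)

lemma mps_const_1 [simp]: "mps_const 1 = 1"
  by (rule mps_eqI) (simp add: mps_coeff_const mps_coeff_one)

lemma mps_const_add: "mps_const (a + b) = mps_const a + mps_const (b :: 'a::comm_ring_1)"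
  by (rule mps_eqI) (simp add: mps_coeff_const)

lemma mps_const_mult: "mps_const (a * b) = mps_const a * mps_const (b :: 'a::comm_ring_1)"
  by (rule mps_eqI) (simp add: mps_coeff_const)

lemma mps_const_uminus: "mps_const (- a) = - mps_const (a :: 'a::comm_ring_1)"
  using mps_const_add[of a "- a"] by (simp add: eq_neg_iff_add_eq_0 add.commute)

lemma mps_const_diff: "mps_const (a - b) = mps_const a - mps_const (b :: 'a::comm_ring_1)"
  using mps_const_add[of a "- b"] by (simp add: mps_const_uminus)

lemma mps_const_sum: "mps_const (\<Sum>i\<in>A. f i) = (\<Sum>i\<in>A. mps_const (f i :: 'a::comm_ring_1))"
  by (induction A rule: infinite_finite_induct) (simp_all add: mps_const_add)

lemma mps_const_of_nat: "mps_const (of_nat n) = (of_nat n :: 'a::comm_ring_1 mps)"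
  by (induction n) (auto simp: mps_const_add)

lemma mps_coeff_power_sum:
  "mps_coeff (power_sum k) m = (if \<exists>i. m = replicate_mset k i then 1 else 0)"
  unfolding power_sum_def by (subst Abs_mps_inverse) auto

text \<open>A divisor of m counted by p_k is some x_i^k. For k > 0 these monomials are distinct and
  only the finitely many variables of m matter, whereas \<open>power_sum 0\<close> is the series
  1.\<close>

lemma mps_coeff_power_sum_times:
  assumes "k > 0"
  shows "mps_coeff (power_sum k * f) m =
           (\<Sum>i | i \<in># m \<and> k \<le> count m i. mps_coeff f (m - replicate_mset k i))"
proof -
  let ?I = "{i. i \<in># m \<and> k \<le> count m i}"
  have inj: "inj_on (replicate_mset k) ?I"
    using assms by (auto simp: inj_on_def replicate_mset_eq_iff)
  have sub: "replicate_mset k i \<subseteq># m \<longleftrightarrow> k \<le> count m i" for i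
    by (simp flip: count_le_replicate_mset_subset_eq)
  have "mps_coeff (power_sum k * f) m = (\<Sum>a \<in> replicate_mset k ` ?I. mps_coeff (power_sum k) a
      * mps_coeff f (m - a))"
    unfolding mps_coeff_times
  proof (rule sum.mono_neutral_right[OF finite_submultisets])
    show "replicate_mset k ` ?I \<subseteq> {a. a \<subseteq># m}"
      using sub by auto
    have "k \<le> count m i \<Longrightarrow> i \<in># m" for i
      using assms by (metis count_greater_zero_iff less_le_trans)
    thus "\<forall>a\<in>{a. a \<subseteq># m} - replicate_mset k ` ?I. mps_coeff (power_sum k) a * mps_coeff f (m - a) = 0"
      using sub by (auto simp: mps_coeff_power_sum)
  qed
  also have "\<dots> = (\<Sum>i\<in>?I. mps_coeff f (m - replicate_mset k i))"
    by (subst sum.reindex[OF inj], intro sum.cong) (auto simp: mps_coeff_power_sum)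
  finally show ?thesis .
qed

lemma psum_prod_empty [simp]: "psum_prod {#} = 1"
  by (simp add: psum_prod_def)

lemma psum_prod_add [simp]: "psum_prod (add_mset k \<mu>) = power_sum k * psum_prod \<mu>"
  by (simp add: psum_prod_def)

lemma shape_add_replicate:
  assumes "i \<notin># m" "k > 0"
  shows "shape (m + replicate_mset k i) = add_mset k (shape m)"
proof -
  have "set_mset (m + replicate_mset k i) = insert i (set_mset m)"
    using assms by auto
  moreover have "image_mset (count (m + replicate_mset k i)) (mset_set (set_mset m)) =
      image_mset (count m) (mset_set (set_mset m))"
    using assms by (intro image_mset_cong) auto
  ultimately show ?thesis
    using assms by (simp add: shape_def not_in_iff)
qed

lemma shape_empty [simp]: "shape {#} = {#}"
  by (simp add: shape_def)

lemma size_shape: "size (shape m) = card (set_mset m)"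
  by (simp add: shape_def)

lemma zero_notin_shape: "0 \<notin># shape m"
  by (auto simp: shape_def count_eq_zero_iff)

lemma sum_mset_shape: "sum_mset (shape m) = size m"
  by (simp add: shape_def size_multiset_overloaded_eq sum_unfold_sum_mset)

text \<open>Each part is the exponent of some variable, and deleting that variable leaves a monomial
  with the remaining parts. This makes inductions on a partition available for monomials.\<close>

lemma shape_eq_add_msetE:
  assumes "shape m = add_mset k \<mu>"
  obtains m' i where "m = m' + replicate_mset k i" "i \<notin># m'" "shape m' = \<mu>"
proof -
  have "k \<in># shape m" using assms by simp
  then obtain i where i: "i \<in># m" "count m i = k"
    by (auto simp: shape_def)
  define m' where "m' = m - replicate_mset k i"
  have sub: "replicate_mset k i \<subseteq># m"
    using i by (simp flip: count_le_replicate_mset_subset_eq)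
  hence m: "m = m' + replicate_mset k i" by (simp add: m'_def)
  have "i \<notin># m'" using i by (simp add: m'_def not_in_iff)
  moreover have "k > 0" using i by auto
  ultimately have "shape m = add_mset k (shape m')"
    using m shape_add_replicate by metis
  with assms m \<open>i \<notin># m'\<close> show ?thesis by (intro that[of m' i]) auto
qed

text \<open>The exponent partition is a complete invariant of the orbit of a monomial under
  permutations of the variables, so a symmetric series is determined by one coefficient per
  partition.\<close>

lemma shape_eq_imp_bij:
  "shape m = \<mu> \<Longrightarrow> shape m' = \<mu> \<Longrightarrow> \<exists>\<pi>. bij \<pi> \<and> image_mset \<pi> m = m'"
proof (induction \<mu> arbitrary: m m')
  case empty
  hence "m = {#}" "m' = {#}" by (auto simp: shape_def mset_set_empty_iff)
  thus ?case by (intro exI[of _ id] conjI bij_id) auto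
next
  case (add k \<mu>)
  obtain n i where n: "m = n + replicate_mset k i" "i \<notin># n" "shape n = \<mu>"
    using shape_eq_add_msetE[OF add.prems(1)] by metis
  obtain n' i' where n': "m' = n' + replicate_mset k i'" "i' \<notin># n'" "shape n' = \<mu>"
    using shape_eq_add_msetE[OF add.prems(2)] by metis
  obtain \<pi> where \<pi>: "bij \<pi>" "image_mset \<pi> n = n'"
    using add.IH n(3) n'(3) by blast
  \<comment> \<open>The transposition redirects \<open>\<pi> i\<close> to \<open>i'\<close>. Neither
    variable occurs in \<open>n'\<close>, so what the induction hypothesis achieved is kept.\<close>
  define \<tau> where "\<tau> = transpose (\<pi> i) i'"
  have "\<pi> i \<notin># n'"
    using \<pi> n(2) by (metis bij_is_inj inj_image_mem_iff set_image_mset)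
  hence "image_mset \<tau> n' = image_mset id n'"
    using n'(2) by (intro image_mset_cong) (auto simp: \<tau>_def transpose_def)
  hence "image_mset (\<tau> \<circ> \<pi>) n = n'"
    using \<pi>(2) by (simp flip: multiset.map_comp)
  hence "image_mset (\<tau> \<circ> \<pi>) m = m'"
    by (simp add: n(1) n'(1) \<tau>_def)
  moreover have "bij (\<tau> \<circ> \<pi>)"
    using \<pi>(1) by (simp add: \<tau>_def bij_comp)
  ultimately show ?case by blast
qed

text \<open>
  Merging parts only decreases the number of variables of a monomial, so the transition to monomial
  symmetric functions is triangular with respect to the number of parts.
\<close>

lemma psum_prod_coeff_nonzero:
  assumes "0 \<notin># \<mu>" "mps_coeff (psum_prod \<mu>) m \<noteq> 0"
  shows "card (set_mset m) \<le> size \<mu> \<and> (card (set_mset m) = size \<mu> \<longrightarrow> shape m = \<mu>) \<and> size m = sum_mset \<mu>"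
  using assms
proof (induction \<mu> arbitrary: m)
  case empty
  thus ?case by (auto simp: mps_coeff_one split: if_splits)
next
  case (add k \<mu>)
  have k: "k > 0" using add.prems by (auto intro: gr0I)
  obtain i where i: "k \<le> count m i" "mps_coeff (psum_prod \<mu>) (m - replicate_mset k i) \<noteq> 0"
    using add.prems(2) unfolding psum_prod_add mps_coeff_power_sum_times[OF k]
    by (auto elim: sum.not_neutral_contains_not_neutral)
  define m' where "m' = m - replicate_mset k i"
  have m: "m = m' + replicate_mset k i"
    using i(1) by (simp add: m'_def count_le_replicate_mset_subset_eq)
  have IH: "card (set_mset m') \<le> size \<mu>" "card (set_mset m') = size \<mu> \<Longrightarrow> shape m' = \<mu>"
    "size m' = sum_mset \<mu>"
    using add.IH[of m'] add.prems(1) i(2) m'_def by auto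
  have set: "set_mset m = insert i (set_mset m')" using m k by auto
  show ?case
  proof (intro conjI impI)
    show "card (set_mset m) \<le> size (add_mset k \<mu>)"
      using IH(1) set by (auto simp: card_insert_if)
    show "size m = sum_mset (add_mset k \<mu>)" using m IH(3) by simp
    assume "card (set_mset m) = size (add_mset k \<mu>)"
    hence "i \<notin># m'" "card (set_mset m') = size \<mu>"
      using IH(1) set by (auto simp: card_insert_if split: if_splits)
    thus "shape m = add_mset k \<mu>" using IH(2) m k by (simp add: shape_add_replicate)
  qed
qed

text \<open>The order on Q(q) excludes cancellation: in a sum of nonnegative coefficients one
  positive summand suffices, which makes the diagonal of the triangular transition nonzero.\<close>

lemma psum_prod_coeff_nonneg: "0 \<notin># \<mu> \<Longrightarrow> mps_coeff (psum_prod \<mu>) m \<ge> 0"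
proof (induction \<mu> arbitrary: m)
  case empty
  thus ?case by (auto simp: mps_coeff_one)
next
  case (add k \<mu>)
  thus ?case by (auto simp: mps_coeff_power_sum_times intro!: sum_nonneg)
qed

lemma psum_prod_coeff_shape: "0 \<notin># \<mu> \<Longrightarrow> shape m = \<mu> \<Longrightarrow> mps_coeff (psum_prod \<mu>) m > 0"
proof (induction \<mu> arbitrary: m)
  case empty
  hence "m = {#}" by (auto simp: shape_def mset_set_empty_iff)
  thus ?case by (auto simp: mps_coeff_one)
next
  case (add k \<mu>)
  have k: "k > 0" using add.prems by (auto intro: gr0I)
  obtain n i where n: "m = n + replicate_mset k i" "i \<notin># n" "shape n = \<mu>"
    using shape_eq_add_msetE[OF add.prems(2)] by metis
  have "mps_coeff (psum_prod \<mu>) (m - replicate_mset k i) > 0"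
    using add n by simp
  moreover have "finite {i. i \<in># m \<and> k \<le> count m i}" by simp
  moreover have "i \<in> {i. i \<in># m \<and> k \<le> count m i}" using n(1) k by simp
  ultimately show ?case
    unfolding psum_prod_add mps_coeff_power_sum_times[OF k] using add.prems(1)
    by (intro sum_pos2[where i = i]) (auto intro!: psum_prod_coeff_nonneg)
qed

lemma psum_prod_symmetric:
  assumes "bij \<pi>" "0 \<notin># \<mu>"
  shows "mps_coeff (psum_prod \<mu>) (image_mset \<pi> m) = mps_coeff (psum_prod \<mu>) m"
  using assms(2)
proof (induction \<mu> arbitrary: m)
  case empty
  thus ?case by (auto simp: mps_coeff_one)
next
  case (add k \<mu>)
  have k: "k > 0" using add.prems by (auto intro: gr0I)
  have inj: "inj \<pi>" using assms(1) by (rule bij_is_inj)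
  have cnt: "count (image_mset \<pi> m) (\<pi> i) = count m i" for i
    by (induction m) (use inj in \<open>auto dest: injD\<close>)
  have eq: "{i. i \<in># image_mset \<pi> m \<and> k \<le> count (image_mset \<pi> m) i} = \<pi> ` {i. i \<in># m \<and> k \<le> count m i}"
    using cnt by auto
  show ?case
    unfolding psum_prod_add mps_coeff_power_sum_times[OF k] eq
    using inj add
    by (subst sum.reindex)
       (auto intro!: sum.cong inj_on_subset[OF inj]
             simp flip: count_le_replicate_mset_subset_eq image_mset_Diff image_replicate_mset)
qed

text \<open>The side condition of \<open>in_power_sums\<close>. Since \<open>power_sum 0\<close> is
  1, admitting p_0 would destroy algebraic independence.\<close>

definition good_ppoly :: "ppoly \<Rightarrow> bool" where
  "good_ppoly P \<longleftrightarrow> (\<forall>\<mu> \<in> Poly_Mapping.keys P. 0 \<notin># \<mu>)"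

section \<open>Evaluation at the power sums and algebraic independence\<close>

lemma eval_ppoly_superset:
  assumes "finite A" "Poly_Mapping.keys P \<subseteq> A" "h 0 = 0"
  shows "eval_ppoly h \<phi> P = (\<Sum>\<mu>\<in>A. h (Poly_Mapping.lookup P \<mu>) * (\<Prod>k\<in>#\<mu>. \<phi> k))"
  unfolding eval_ppoly_def using assms
  by (intro sum.mono_neutral_left) (auto simp: in_keys_iff)

lemma eval_ppoly_zero [simp]: "eval_ppoly h \<phi> 0 = 0"
  by (simp add: eval_ppoly_def)

lemma eval_ppoly_add:
  assumes "\<And>a b. h (a + b) = h a + h b" "h 0 = 0"
  shows "eval_ppoly h \<phi> (P + Q) = eval_ppoly h \<phi> P + eval_ppoly h \<phi> Q"
proof -
  let ?A = "Poly_Mapping.keys P \<union> Poly_Mapping.keys Q"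
  have "eval_ppoly h \<phi> S = (\<Sum>\<mu>\<in>?A. h (Poly_Mapping.lookup S \<mu>) * (\<Prod>k\<in>#\<mu>. \<phi> k))"
    if "Poly_Mapping.keys S \<subseteq> ?A" for S
    using that assms(2) by (intro eval_ppoly_superset) auto
  from this[of P] this[of Q] this[of "P + Q"] Poly_Mapping.keys_add[of P Q] show ?thesis
    by (simp add: lookup_add assms(1) algebra_simps sum.distrib)
qed

lemma eval_ppoly_single:
  assumes "h 0 = 0"
  shows "eval_ppoly h \<phi> (Poly_Mapping.single \<mu> c) = h c * (\<Prod>k\<in>#\<mu>. \<phi> k)"
  using assms by (auto simp: eval_ppoly_def)

lemma ppoly_induct [case_names zero add_single]:
  fixes P :: ppoly
  assumes "Q 0" "\<And>P \<mu> c. Q P \<Longrightarrow> Q (P + Poly_Mapping.single \<mu> c)"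
  shows "Q P"
proof -
  have "Q (\<Sum>\<mu>\<in>A. Poly_Mapping.single \<mu> (Poly_Mapping.lookup P \<mu>))" if "finite A" for A
    using that
  proof (induction A rule: finite_induct)
    case (insert \<mu> A)
    thus ?case
      using assms(2)[of "\<Sum>\<mu>\<in>A. Poly_Mapping.single \<mu> (Poly_Mapping.lookup P \<mu>)"]
      by (simp add: add.commute)
  qed (simp add: assms(1))
  moreover have "(\<Sum>\<mu>\<in>Poly_Mapping.keys P. Poly_Mapping.single \<mu> (Poly_Mapping.lookup P \<mu>)) = P"
    by (rule poly_mapping_eqI) (auto simp: lookup_sum lookup_single when_def in_keys_iff)
  ultimately show ?thesis by (metis finite_keys)
qed

lemma eval_ppoly_times_single:
  assumes "\<And>a b. h (a + b) = h a + h b" "h 0 = 0" "\<And>a b. h (a * b) = h a * h b"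
  shows "eval_ppoly h \<phi> (Poly_Mapping.single \<nu> c * P) = h c * (\<Prod>k\<in>#\<nu>. \<phi> k) * eval_ppoly h \<phi> P"
  by (induction P rule: ppoly_induct)
     (simp_all add: eval_ppoly_add eval_ppoly_single assms distrib_left mult_single mult_ac)

lemma good_ppoly_add: "good_ppoly P \<Longrightarrow> good_ppoly Q \<Longrightarrow> good_ppoly (P + Q)"
  using Poly_Mapping.keys_add[of P Q] unfolding good_ppoly_def by blast

lemma good_ppoly_diff: "good_ppoly P \<Longrightarrow> good_ppoly Q \<Longrightarrow> good_ppoly (P - Q)"
  using keys_diff[of P Q] unfolding good_ppoly_def by blast

lemma good_ppoly_times_single:
  assumes "0 \<notin># \<nu>" "good_ppoly P"
  shows "good_ppoly (Poly_Mapping.single \<nu> c * P)"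
  using keys_mult[of "Poly_Mapping.single \<nu> c" P] assms unfolding good_ppoly_def
  by (fastforce split: if_splits)

text \<open>Algebraic independence. Take a longest partition \<open>\<mu>\<close> in the support and
  a monomial of that shape: by triangularity no other partition of the support contributes to its
  coefficient, while the contribution of \<open>\<mu>\<close> is nonzero.\<close>

lemma eval_psum_eq_0:
  assumes "good_ppoly P" "eval_ppoly mps_const power_sum P = 0"
  shows "P = 0"
proof (rule ccontr)
  assume "P \<noteq> 0"
  hence ne: "Poly_Mapping.keys P \<noteq> {}" by simp
  define L where "L = Max (size ` Poly_Mapping.keys P)"
  have "L \<in> size ` Poly_Mapping.keys P"
    unfolding L_def using ne by (intro Max_in) auto
  then obtain \<mu> where \<mu>: "\<mu> \<in> Poly_Mapping.keys P" "size \<mu> = L" by auto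
  have L: "size \<nu> \<le> L" if "\<nu> \<in> Poly_Mapping.keys P" for \<nu>
    unfolding L_def using that by (intro Max_ge) auto
  have "\<exists>m. shape m = \<mu>" if "0 \<notin># \<mu>" for \<mu>
    using that
  proof (induction \<mu>)
    case empty
    show ?case by (intro exI[of _ "{#}"]) simp
  next
    case (add k \<mu>)
    then obtain m where "shape m = \<mu>" by auto
    moreover obtain i where "i \<notin># m"
      using ex_new_if_finite[of "set_mset m"] by auto
    ultimately have "shape (m + replicate_mset k i) = add_mset k \<mu>"
      using shape_add_replicate[of i m k] add.prems by (auto simp: neq0_conv)
    thus ?case by blast
  qed
  then obtain m where m: "shape m = \<mu>" using \<mu> assms(1) by (auto simp: good_ppoly_def)
  have "0 = mps_coeff (eval_ppoly mps_const power_sum P) m" using assms(2) by simp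
  also have "\<dots> = (\<Sum>\<nu>\<in>Poly_Mapping.keys P. Poly_Mapping.lookup P \<nu> * mps_coeff (psum_prod \<nu>) m)"
    by (simp add: eval_ppoly_def mps_coeff_sum psum_prod_def)
  also have "\<dots> = (\<Sum>\<nu>\<in>{\<mu>}. Poly_Mapping.lookup P \<nu> * mps_coeff (psum_prod \<nu>) m)"
  proof (rule sum.mono_neutral_right)
    show "\<forall>\<nu>\<in>Poly_Mapping.keys P - {\<mu>}. Poly_Mapping.lookup P \<nu> * mps_coeff (psum_prod \<nu>) m = 0"
    proof
      fix \<nu> assume \<nu>: "\<nu> \<in> Poly_Mapping.keys P - {\<mu>}"
      have "card (set_mset m) = L" using m \<mu>(2) size_shape by metis
      hence "mps_coeff (psum_prod \<nu>) m = 0"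
        using psum_prod_coeff_nonzero[of \<nu> m] L[of \<nu>] \<nu> m assms(1) by (force simp: good_ppoly_def)
      thus "Poly_Mapping.lookup P \<nu> * mps_coeff (psum_prod \<nu>) m = 0" by simp
    qed
  qed (use \<mu> in auto)
  also have "\<dots> \<noteq> 0"
    using \<mu>(1) psum_prod_coeff_shape[OF _ m] assms(1)
    by (force simp: good_ppoly_def in_keys_iff)
  finally show False by simp
qed

lemma eval_psum_inj:
  assumes "good_ppoly P" "good_ppoly Q"
    and "eval_ppoly mps_const power_sum P = eval_ppoly mps_const power_sum Q"
  shows "P = Q"
proof -
  have "eval_ppoly mps_const power_sum ((P - Q) + Q) =
        eval_ppoly mps_const power_sum (P - Q) + eval_ppoly mps_const power_sum Q"
    by (rule eval_ppoly_add) (auto simp: mps_const_add)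
  hence "eval_ppoly mps_const power_sum (P - Q) = 0" using assms(3) by simp
  from eval_psum_eq_0[OF good_ppoly_diff[OF assms(1,2)] this] show ?thesis by simp
qed

lemma in_power_sums_eval:
  assumes "good_ppoly P"
  shows "in_power_sums (eval_ppoly mps_const power_sum P) = P"
  unfolding in_power_sums_def using assms eval_psum_inj
  by (intro the_equality) (auto simp: good_ppoly_def)

text \<open>
  Only \<open>Sym \<subseteq> PS\<close> is needed: \<open>in_power_sums\<close> is well defined on all of \<open>PS\<close> by algebraic
  independence alone.
\<close>

inductive_set PS :: "qrat mps set" where
  PS_const: "mps_const c \<in> PS"
| PS_times: "k > 0 \<Longrightarrow> F \<in> PS \<Longrightarrow> power_sum k * F \<in> PS"
| PS_add: "F \<in> PS \<Longrightarrow> G \<in> PS \<Longrightarrow> F + G \<in> PS"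

lemma PS_cmult: "F \<in> PS \<Longrightarrow> mps_const c * F \<in> PS"
proof (induction rule: PS.induct)
  case (PS_const d)
  thus ?case using PS.PS_const[of "c * d"] by (simp add: mps_const_mult)
next
  case (PS_times k F)
  thus ?case using PS.PS_times[of k "mps_const c * F"] by (simp add: mult_ac)
next
  case (PS_add F G)
  thus ?case by (simp add: distrib_left PS.PS_add)
qed

lemma PS_0: "0 \<in> PS"
  using PS_const[of 0] by simp

lemma PS_1: "1 \<in> PS"
  using PS_const[of 1] by simp

lemma PS_sum: "(\<And>i. i \<in> A \<Longrightarrow> f i \<in> PS) \<Longrightarrow> (\<Sum>i\<in>A. f i) \<in> PS"
  by (induction A rule: infinite_finite_induct) (auto simp: PS_0 PS_add)

lemma psum_prod_PS: "0 \<notin># \<mu> \<Longrightarrow> psum_prod \<mu> \<in> PS"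
  by (induction \<mu>) (auto simp: PS_1 neq0_conv intro: PS_times)

text \<open>Induction on a bound L for the number of variables in a monomial: the part of F with the
  most variables is matched by a combination of power sum products and subtracted. The degree bound
  N keeps that combination finite.\<close>

lemma Sym_subset_PS: "Sym \<subseteq> PS"
proof -
  have *: "F \<in> PS"
    if "\<And>\<pi> m. bij \<pi> \<Longrightarrow> mps_coeff F (image_mset \<pi> m) = mps_coeff F m"
       "\<And>m. mps_coeff F m \<noteq> 0 \<Longrightarrow> size m \<le> N \<and> card (set_mset m) \<le> L" for F N L
    using that
  proof (induction L arbitrary: F)
    case 0
    have "F = mps_const (mps_coeff F {#})"
    proof (rule mps_eqI)
      fix m show "mps_coeff F m = mps_coeff (mps_const (mps_coeff F {#})) m"
        using 0(2)[of m] by (auto simp: mps_coeff_const)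
    qed
    thus ?case by (metis PS_const)
  next
    case (Suc L)
    define M where "M = shape ` {m. mps_coeff F m \<noteq> 0 \<and> card (set_mset m) = Suc L}"
    have "M \<subseteq> mset ` {xs. set xs \<subseteq> {..N} \<and> length xs \<le> Suc L}"
    proof
      fix \<mu> assume "\<mu> \<in> M"
      then obtain m where m: "mps_coeff F m \<noteq> 0" "card (set_mset m) = Suc L" "\<mu> = shape m"
        by (auto simp: M_def)
      obtain xs where xs: "mset xs = \<mu>" using ex_mset by blast
      have "x \<le> N" if "x \<in> set xs" for x
      proof -
        have "x \<in># \<mu>" using that xs by auto
        hence "x \<le> sum_mset \<mu>" by (metis le_add1 mset_add sum_mset.add_mset)
        thus ?thesis using m Suc.prems(2)[OF m(1)] by (simp add: sum_mset_shape)
      qed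
      moreover have "length xs = Suc L" using xs m size_shape by (metis size_mset)
      ultimately show "\<mu> \<in> mset ` {xs. set xs \<subseteq> {..N} \<and> length xs \<le> Suc L}"
        using xs by (intro image_eqI[of _ _ xs]) auto
    qed
    hence finM: "finite M"
      by (rule finite_subset) (intro finite_imageI finite_lists_length_le; simp)
    have M0: "0 \<notin># \<mu>" if "\<mu> \<in> M" for \<mu>
      using that zero_notin_shape by (auto simp: M_def)
    define r where "r \<mu> = (SOME m. shape m = \<mu>)" for \<mu>
    have Fr: "mps_coeff F (r (shape m)) = mps_coeff F m" for m
    proof -
      have "shape (r (shape m)) = shape m" unfolding r_def by (rule someI) simp
      then obtain \<pi> where "bij \<pi>" "image_mset \<pi> m = r (shape m)"
        using shape_eq_imp_bij by metis
      thus ?thesis using Suc.prems(1) by metis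
    qed
    have Pr: "mps_coeff (psum_prod (shape m)) (r (shape m)) = mps_coeff (psum_prod (shape m)) m" for m
    proof -
      have "shape (r (shape m)) = shape m" unfolding r_def by (rule someI) simp
      then obtain \<pi> where "bij \<pi>" "image_mset \<pi> m = r (shape m)"
        using shape_eq_imp_bij by metis
      thus ?thesis using psum_prod_symmetric[OF _ zero_notin_shape] by metis
    qed
    \<comment> \<open>Each quotient is the ratio of the two coefficients at a representative of the
      shape. Both series are symmetric, so H then agrees with F on every monomial with exactly
      \<open>Suc L\<close> variables.\<close>
    define H where "H = (\<Sum>\<mu>\<in>M. mps_const (mps_coeff F (r \<mu>) / mps_coeff (psum_prod \<mu>) (r \<mu>))
        * psum_prod \<mu>)"
    have Hc: "mps_coeff H m = (\<Sum>\<mu>\<in>M. mps_coeff F (r \<mu>) / mps_coeff (psum_prod \<mu>) (r \<mu>)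
        * mps_coeff (psum_prod \<mu>) m)" for m
      by (simp add: H_def mps_coeff_sum)
    have H_top: "mps_coeff H m = mps_coeff F m" if "card (set_mset m) = Suc L" for m
    proof -
      have zero: "mps_coeff (psum_prod \<mu>) m = 0" if "\<mu> \<in> M" "\<mu> \<noteq> shape m" for \<mu>
      proof -
        have "size \<mu> = Suc L" using that by (auto simp: M_def size_shape)
        thus ?thesis
          using psum_prod_coeff_nonzero[OF M0] that \<open>card (set_mset m) = Suc L\<close> by metis
      qed
      show ?thesis
      proof (cases "shape m \<in> M")
        case True
        have "mps_coeff H m = (\<Sum>\<mu>\<in>{shape m}. mps_coeff F (r \<mu>) / mps_coeff (psum_prod \<mu>) (r \<mu>)
            * mps_coeff (psum_prod \<mu>) m)"
          unfolding Hc using True finM zero by (intro sum.mono_neutral_right) auto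
        also have "\<dots> = mps_coeff F m"
          using psum_prod_coeff_shape[OF zero_notin_shape refl, of m] by (simp add: Fr Pr)
        finally show ?thesis .
      next
        case False
        hence "mps_coeff F m = 0" using that by (auto simp: M_def)
        moreover have "mps_coeff H m = 0" unfolding Hc using zero False
          by (intro sum.neutral) auto
        ultimately show ?thesis by simp
      qed
    qed
    have H_supp: "size m \<le> N \<and> card (set_mset m) \<le> Suc L" if Hm: "mps_coeff H m \<noteq> 0" for m
    proof -
      obtain \<mu> where \<mu>: "\<mu> \<in> M" "mps_coeff (psum_prod \<mu>) m \<noteq> 0"
        using Hm unfolding Hc by (auto elim: sum.not_neutral_contains_not_neutral)
      from \<mu>(1) obtain n where n: "mps_coeff F n \<noteq> 0" "card (set_mset n) = Suc L" "\<mu> = shape n"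
        by (auto simp: M_def)
      show ?thesis
        using psum_prod_coeff_nonzero[OF M0 \<mu>(2)] \<mu>(1) n Suc.prems(2)[OF n(1)]
        by (simp add: sum_mset_shape size_shape)
    qed
    have "F - H \<in> PS"
    proof (rule Suc.IH)
      fix \<pi> :: "nat \<Rightarrow> nat" and m assume "bij \<pi>"
      thus "mps_coeff (F - H) (image_mset \<pi> m) = mps_coeff (F - H) m"
        using Suc.prems(1) by (simp add: Hc psum_prod_symmetric M0)
    next
      fix m assume nz: "mps_coeff (F - H) m \<noteq> 0"
      hence "mps_coeff F m \<noteq> 0 \<or> mps_coeff H m \<noteq> 0" by auto
      hence "size m \<le> N \<and> card (set_mset m) \<le> Suc L" using H_supp Suc.prems(2) by blast
      moreover have "card (set_mset m) \<noteq> Suc L" using nz H_top by auto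
      ultimately show "size m \<le> N \<and> card (set_mset m) \<le> L" by auto
    qed
    moreover have "H \<in> PS"
      unfolding H_def by (intro PS_sum PS_cmult psum_prod_PS M0)
    ultimately have "(F - H) + H \<in> PS" by (rule PS_add)
    thus ?case by simp
  qed
  show ?thesis
  proof
    fix F assume "F \<in> Sym"
    then obtain N where N: "\<And>m. mps_coeff F m \<noteq> 0 \<Longrightarrow> size m \<le> N"
      and sym: "\<And>\<pi> m. bij \<pi> \<Longrightarrow> mps_coeff F (image_mset \<pi> m) = mps_coeff F m"
      by (auto simp: Sym_def)
    \<comment> \<open>The degree bound also bounds the number of variables, so the induction can
      start at L = N.\<close>
    have "card (set_mset m) \<le> size m" for m :: "nat multiset"
      by (metis card_length ex_mset set_mset_mset size_mset)
    with N have "size m \<le> N \<and> card (set_mset m) \<le> N" if "mps_coeff F m \<noteq> 0" for m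
      using that le_trans by blast
    with * sym show "F \<in> PS" by blast
  qed
qed

lemma PS_evalE:
  assumes "F \<in> PS"
  obtains P where "good_ppoly P" "F = eval_ppoly mps_const power_sum P"
proof -
  have "\<exists>P. good_ppoly P \<and> F = eval_ppoly mps_const power_sum P"
    using assms
  proof (induction rule: PS.induct)
    case (PS_const c)
    show ?case
      by (rule exI[of _ "Poly_Mapping.single {#} c"]) (auto simp: good_ppoly_def eval_ppoly_single)
  next
    case (PS_times k F)
    then obtain P where "good_ppoly P" "F = eval_ppoly mps_const power_sum P" by blast
    thus ?case using PS_times(1)
      by (intro exI[of _ "Poly_Mapping.single {#k#} 1 * P"] conjI good_ppoly_times_single)
         (auto simp: eval_ppoly_times_single mps_const_add mps_const_mult)
  next
    case (PS_add F G)
    then obtain P Q where "good_ppoly P" "F = eval_ppoly mps_const power_sum P"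
      "good_ppoly Q" "G = eval_ppoly mps_const power_sum Q" by blast
    thus ?case
      by (intro exI[of _ "P + Q"] conjI good_ppoly_add) (auto simp: eval_ppoly_add mps_const_add)
  qed
  thus ?thesis using that by blast
qed

section \<open>Plethysm respects sums, scalars and multiplication by power sums\<close>

lemma scal_add: "scal (a + b) = scal a + scal b"
  by (simp add: mps_const_add flip: fls_plus_const)

lemma scal_mult: "scal (a * b) = scal a * scal b"
  by (simp add: mps_const_mult fls_const_mult_const)

lemma pleth_add:
  assumes "F \<in> PS" "G \<in> PS"
  shows "pleth (F + G) E = pleth F E + pleth G E"
proof -
  obtain P where P: "good_ppoly P" "F = eval_ppoly mps_const power_sum P"
    using assms(1) by (rule PS_evalE)
  obtain Q where Q: "good_ppoly Q" "G = eval_ppoly mps_const power_sum Q"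
    using assms(2) by (rule PS_evalE)
  have "F + G = eval_ppoly mps_const power_sum (P + Q)"
    using P Q by (simp add: eval_ppoly_add mps_const_add)
  thus ?thesis
    using P Q
    by (simp add: pleth_def in_power_sums_eval good_ppoly_add eval_ppoly_add[where h = scal] scal_add)
qed

lemma pleth_power_sum_times:
  assumes "F \<in> PS" "k > 0"
  shows "pleth (power_sum k * F) E = pk k E * pleth F E"
proof -
  obtain P where P: "good_ppoly P" "F = eval_ppoly mps_const power_sum P"
    using assms(1) by (rule PS_evalE)
  let ?Q = "Poly_Mapping.single {#k#} 1 * P :: ppoly"
  have "power_sum k * F = eval_ppoly mps_const power_sum ?Q"
    using P by (simp add: eval_ppoly_times_single mps_const_add mps_const_mult)
  moreover have "good_ppoly ?Q" using P assms(2) by (intro good_ppoly_times_single) auto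
  ultimately show ?thesis
    using P by (simp add: pleth_def in_power_sums_eval eval_ppoly_times_single[where h =
        scal] scal_add scal_mult)
qed

lemma pleth_const: "pleth (mps_const c) E = scal c"
proof -
  have "mps_const c = eval_ppoly mps_const power_sum (Poly_Mapping.single {#} c)"
    by (simp add: eval_ppoly_single)
  moreover have "good_ppoly (Poly_Mapping.single {#} c)" by (auto simp: good_ppoly_def)
  ultimately show ?thesis
    by (simp add: pleth_def in_power_sums_eval eval_ppoly_single[where h = scal])
qed

lemma pleth_cmult: "F \<in> PS \<Longrightarrow> pleth (mps_const c * F) E = scal c * pleth F E"
proof (induction rule: PS.induct)
  case (PS_const d)
  thus ?case by (metis mps_const_mult pleth_const scal_mult)
next
  case (PS_times k F)
  have "pleth (mps_const c * (power_sum k * F)) E = pleth (power_sum k * (mps_const c * F)) E"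
    by (simp add: mult_ac)
  also have "\<dots> = pk k E * (scal c * pleth F E)"
    using PS_times by (subst pleth_power_sum_times) (auto intro: PS_cmult)
  also have "\<dots> = scal c * pleth (power_sum k * F) E"
    using PS_times by (simp add: pleth_power_sum_times mult.left_commute)
  finally show ?case .
next
  case (PS_add F G)
  thus ?case by (simp add: distrib_left pleth_add PS_cmult)
qed

section \<open>The operators on products of power sums\<close>

lemma qrat_subst_mult:
  assumes "k > 0"
  shows "qrat_subst k (x * y) = qrat_subst k x * qrat_subst k y"
  by (cases x, cases y) (simp add: qrat_subst_Fract assms pcompose_mult)

lemma pcompose_monom_nonzero:
  fixes p :: "rat poly"
  assumes "k > 0" "p \<noteq> 0"
  shows "pcompose p (monom 1 k) \<noteq> 0"
  using assms by (auto simp: pcompose_eq_0_iff degree_monom_eq)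

lemma qrat_subst_diff:
  assumes "k > 0"
  shows "qrat_subst k (x - y) = qrat_subst k x - qrat_subst k y"
  by (cases x, cases y)
     (simp add: qrat_subst_Fract assms pcompose_mult pcompose_diff pcompose_monom_nonzero)

lemma qrat_subst_0 [simp]: "k > 0 \<Longrightarrow> qrat_subst k 0 = 0"
  by (simp add: Zero_fract_def qrat_subst_Fract pcompose_1)

lemma qrat_subst_1 [simp]: "k > 0 \<Longrightarrow> qrat_subst k 1 = 1"
  by (simp add: One_fract_def qrat_subst_Fract pcompose_1)

lemma qrat_subst_uminus: "k > 0 \<Longrightarrow> qrat_subst k (- x) = - qrat_subst k x"
  using qrat_subst_diff[of k 0 x] by simp

lemma qrat_subst_inverse:
  assumes "k > 0"
  shows "qrat_subst k (inverse x) = inverse (qrat_subst k x)"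
proof (cases "x = 0")
  case False
  hence "qrat_subst k x * qrat_subst k (inverse x) = 1"
    using assms by (simp flip: qrat_subst_mult)
  thus ?thesis by (metis inverse_unique)
qed (use assms in simp)

lemma qrat_subst_divide:
  assumes "k > 0"
  shows "qrat_subst k (x / y) = qrat_subst k x / qrat_subst k y"
  using assms by (simp add: divide_inverse qrat_subst_mult qrat_subst_inverse)

lemma qrat_subst_power:
  assumes "k > 0"
  shows "qrat_subst k (x ^ n) = qrat_subst k x ^ n"
  using assms by (induction n) (auto simp: qrat_subst_mult)

lemma qrat_subst_power_int:
  assumes "k > 0"
  shows "qrat_subst k (x powi n) = qrat_subst k x powi n"
  using assms by (auto simp: power_int_def qrat_subst_power qrat_subst_inverse)

lemma qvar_power: "qvar ^ n = Fract (monom 1 n) 1"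
proof (induction n)
  case (Suc n)
  thus ?case by (simp add: qvar_def monom_Suc)
qed (simp add: One_fract_def)

lemma qrat_subst_qvar: "k > 0 \<Longrightarrow> qrat_subst k qvar = qvar ^ k"
  by (simp add: qvar_power) (simp add: qvar_def qrat_subst_Fract pcompose_pCons pcompose_1)

lemma qvar_nonzero: "qvar \<noteq> 0"
  by (simp add: qvar_def Zero_fract_def eq_fract)

lemma qvar_power_neq_1: "n > 0 \<Longrightarrow> qvar ^ n \<noteq> 1"
proof
  assume n: "n > 0" and "qvar ^ n = 1"
  hence "monom 1 n = (1 :: rat poly)"
    by (simp add: qvar_power One_fract_def eq_fract)
  hence "degree (monom 1 n :: rat poly) = 0" by simp
  thus False using n by (simp add: degree_monom_eq)
qed

lemma qvar_power_int_neq_1: "n \<noteq> 0 \<Longrightarrow> qvar powi n \<noteq> 1"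
  using qvar_power_neq_1[of "nat n"] qvar_power_neq_1[of "nat (- n)"]
  by (auto simp: power_int_def power_inverse)

lemma tvar_eq: "tvar = inverse qvar"
  by (simp add: tvar_def divide_inverse)

text \<open>\<open>gamma_coeff k u\<close> is \<open>p\<^sub>k[M[u]\<^sub>q]\<close> and \<open>beta_coeff k u\<close> is \<open>p\<^sub>k[[u]\<^sub>t]\<close>.\<close>

definition gamma_coeff :: "nat \<Rightarrow> int \<Rightarrow> qrat" where
  "gamma_coeff k u = (1 - inverse (qvar ^ k)) * (1 - qvar powi (int k * u))"

definition beta_coeff :: "nat \<Rightarrow> int \<Rightarrow> qrat" where
  "beta_coeff k u = (1 - qvar powi (- int k * u)) / (1 - inverse (qvar ^ k))"

lemma qrat_subst_gamma:
  assumes "k > 0"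
  shows "qrat_subst k (Mq * qint qvar u) = gamma_coeff k u"
proof -
  \<comment> \<open>The factor 1 - q of M cancels the denominator of [u]_q.\<close>
  have *: "Mq * qint qvar u = (1 - tvar) * (1 - qvar powi u)"
    using qvar_power_neq_1[of 1] by (simp add: Mq_def qint_def)
  show ?thesis
    unfolding * using assms
    by (simp add: gamma_coeff_def qrat_subst_mult qrat_subst_diff qrat_subst_power_int qrat_subst_qvar
        tvar_eq qrat_subst_inverse power_int_mult)
qed

lemma qrat_subst_beta:
  assumes "k > 0"
  shows "qrat_subst k (qint tvar u) = beta_coeff k u"
  using assms
  by (simp add: beta_coeff_def qint_def qrat_subst_divide qrat_subst_diff qrat_subst_power_int qrat_subst_qvar
      tvar_eq qrat_subst_inverse power_int_mult power_int_minus power_int_inverse)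

section \<open>The substitution p_k[E] on plethystic expressions\<close>

lemma repeat_mset_inj: "k > 0 \<Longrightarrow> repeat_mset k n = repeat_mset k m \<longleftrightarrow> n = m"
  by (auto simp: multiset_eq_iff)

lemma mps_coeff_pk_coeff_repeat:
  assumes "k > 0"
  shows "mps_coeff (pk_coeff k f) (repeat_mset k n) = qrat_subst k (mps_coeff f n)"
proof -
  have "{n'. repeat_mset k n' = repeat_mset k n} = {n}"
    using assms repeat_mset_inj by auto
  thus ?thesis by (simp add: pk_coeff_def Abs_mps_inverse)
qed

lemma mps_coeff_pk_coeff_other:
  assumes "\<And>n. m \<noteq> repeat_mset k n"
  shows "mps_coeff (pk_coeff k f) m = 0"
proof -
  have "{n. repeat_mset k n = m} = {}" using assms by auto
  thus ?thesis by (simp add: pk_coeff_def Abs_mps_inverse)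
qed

lemma pk_coeff_eqI:
  assumes "k > 0"
    and "\<And>n. mps_coeff g (repeat_mset k n) = qrat_subst k (mps_coeff f n)"
    and "\<And>m. (\<And>n. m \<noteq> repeat_mset k n) \<Longrightarrow> mps_coeff g m = 0"
  shows "pk_coeff k f = g"
proof (rule mps_eqI)
  fix m
  show "mps_coeff (pk_coeff k f) m = mps_coeff g m"
    by (cases "\<exists>n. m = repeat_mset k n")
       (use assms in \<open>auto simp: mps_coeff_pk_coeff_repeat mps_coeff_pk_coeff_other\<close>)
qed

lemma pk_coeff_0 [simp]: "k > 0 \<Longrightarrow> pk_coeff k 0 = 0"
  by (rule pk_coeff_eqI) auto

lemma pk_coeff_const:
  assumes "k > 0"
  shows "pk_coeff k (mps_const c) = mps_const (qrat_subst k c)"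
proof (rule pk_coeff_eqI[OF assms])
  fix m :: "nat multiset" assume "\<And>n. m \<noteq> repeat_mset k n"
  from this[of "{#}"] show "mps_coeff (mps_const (qrat_subst k c)) m = 0"
    by (simp add: mps_coeff_const)
next
  fix n :: "nat multiset"
  show "mps_coeff (mps_const (qrat_subst k c)) (repeat_mset k n) =
      qrat_subst k (mps_coeff (mps_const c) n)"
    using repeat_mset_inj[OF assms, of n "{#}"] assms by (simp add: mps_coeff_const)
qed

lemma repeat_mset_replicate: "repeat_mset k (replicate_mset n i) = replicate_mset (k * n) i"
  by (auto simp: multiset_eq_iff)

lemma pk_coeff_const_times_p1:
  assumes "k > 0"
  shows "pk_coeff k (mps_const c * power_sum 1) = mps_const (qrat_subst k c) * power_sum k"
proof (rule pk_coeff_eqI[OF assms])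
  fix n :: "nat multiset"
  have "(\<exists>i. repeat_mset k n = replicate_mset k i) \<longleftrightarrow> (\<exists>i. n = replicate_mset 1 i)"
    using repeat_mset_inj[OF assms, of n] repeat_mset_replicate[of k 1] by (metis mult.right_neutral)
  thus "mps_coeff (mps_const (qrat_subst k c) * power_sum k) (repeat_mset k n) =
      qrat_subst k (mps_coeff (mps_const c * power_sum 1) n)"
    using assms by (simp add: mps_coeff_power_sum)
next
  fix m :: "nat multiset" assume "\<And>n. m \<noteq> repeat_mset k n"
  hence "\<nexists>i. m = replicate_mset k i"
    using repeat_mset_replicate[of k 1] by (metis mult.right_neutral)
  thus "mps_coeff (mps_const (qrat_subst k c) * power_sum k) m = 0"
    by (simp add: mps_coeff_power_sum)
qed

lemma pk_nth:
  assumes "k > 0"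
  shows "fls_nth (pk k E) n = (if int k dvd n then pk_coeff k (fls_nth E (n div int k)) else 0)"
proof -
  \<comment> \<open>\<open>Abs_fls\<close> is meaningful only for coefficients that vanish far to
    the left; this holds because \<open>pk_coeff k\<close> sends 0 to 0.\<close>
  have "fls_nth (Abs_fls (\<lambda>n. pk_coeff k (fls_nth E n))) m = pk_coeff k (fls_nth E m)" for m
    using assms by (intro nth_Abs_fls_lower_bound[of "fls_subdegree E"]) simp
  thus ?thesis using assms by (simp add: pk_def fls_nth_compose_power)
qed

lemma pk_X_plus:
  assumes "k > 0"
  shows "pk k (XX + scal c * fls_X_inv) = fls_const (power_sum k) + scal (qrat_subst k c)
      * fls_X_inv ^ k"
proof (rule fls_eqI)
  fix n
  have nth: "fls_nth (XX + scal c * fls_X_inv) m =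
      (if m = 0 then mps_const 1 * power_sum 1 else if m = -1 then mps_const c else 0)" for m
    by simp
  have pk: "pk_coeff k (fls_nth (XX + scal c * fls_X_inv) m) =
     (if m = 0 then power_sum k else if m = -1 then mps_const (qrat_subst k c) else 0)" for m
    unfolding nth using assms pk_coeff_const_times_p1[OF assms, of 1]
    by (simp add: pk_coeff_const)
  have 1: "n div int k = 0 \<longleftrightarrow> n = 0" "n div int k = -1 \<longleftrightarrow> n = - int k" if "int k dvd n"
    using that assms nonzero_mult_div_cancel_right[of "int k" "-1"] by (auto elim!: dvdE)
  show "fls_nth (pk k (XX + scal c * fls_X_inv)) n =
      fls_nth (fls_const (power_sum k) + scal (qrat_subst k c) * fls_X_inv ^ k) n"
    unfolding pk_nth[OF assms] pk using assms 1 by auto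
qed

lemma pk_minus_zX:
  assumes "k > 0"
  shows "fls_nth (pk k (- (fls_X * scal c * XX))) n =
    (if n = int k then - (mps_const (qrat_subst k c) * power_sum k) else 0)"
proof -
  have "fls_X * scal c * XX = fls_X * fls_const (mps_const c * power_sum 1)"
    by (simp add: mult.assoc fls_const_mult_const)
  hence nth: "fls_nth (- (fls_X * scal c * XX)) m =
      (if m = 1 then mps_const (- c) * power_sum 1 else 0)" for m
    by (simp add: fls_X_times_conv_shift mps_const_uminus)
  have pk: "pk_coeff k (fls_nth (- (fls_X * scal c * XX)) m) =
     (if m = 1 then - (mps_const (qrat_subst k c) * power_sum k) else 0)" for m
    unfolding nth using assms pk_coeff_const_times_p1[OF assms, of "- c"]
    by (simp add: qrat_subst_uminus[OF assms] mps_const_uminus)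
  have 1: "n div int k = 1 \<longleftrightarrow> n = int k" if "int k dvd n"
    using that assms by auto
  show ?thesis
    unfolding pk_nth[OF assms] pk using assms 1 by auto
qed

section \<open>The z-adic exponential and Omega\<close>

lemma fls_LIMSEQ_I:
  fixes S :: "nat \<Rightarrow> 'a::group_add fls"
  assumes "\<And>N m. m < int N \<Longrightarrow> fls_nth (S N) m = fls_nth L m"
  shows "S \<longlonglongrightarrow> L"
proof (rule metric_LIMSEQ_I)
  fix e :: real assume "e > 0"
  then obtain N where N: "(1 / 2) ^ N < e"
    using real_arch_pow_inv[of e "1 / 2"] by auto
  have "dist (S n) L < e" if "n \<ge> N" for n
  proof (cases "S n = L")
    case True
    thus ?thesis using \<open>e > 0\<close> by simp
  next
    case False
    \<comment> \<open>The z-adic distance is 2 to the minus subdegree of the difference, so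
      agreement below degree n bounds it by 2^-n. Infinite sums thus reduce to finite sums of
      coefficients.\<close>
    hence deg: "int n \<le> fls_subdegree (S n - L)"
      using assms by (intro fls_subdegree_geI) auto
    hence "N \<le> nat (fls_subdegree (S n - L))" using that by simp
    hence "(1 / 2 :: real) ^ nat (fls_subdegree (S n - L)) \<le> (1 / 2) ^ N"
      by (intro power_decreasing) auto
    thus ?thesis using False deg N by (simp add: dist_fls_def power_one_over inverse_eq_divide)
  qed
  thus "\<exists>N. \<forall>n\<ge>N. dist (S n) L < e" by blast
qed

lemma fls_sums_I:
  fixes f :: "nat \<Rightarrow> 'a::ab_group_add fls"
  assumes "\<And>N m. m < int N \<Longrightarrow> (\<Sum>i<N. fls_nth (f i) m) = fls_nth L m"
  shows "suminf f = L"
proof -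
  have "f sums L"
    unfolding sums_def using assms by (intro fls_LIMSEQ_I) (simp add: fls_nth_sum)
  thus ?thesis by (rule sums_unique[symmetric])
qed

text \<open>The exponential is recorded only by its initial value and H' = s'H, the form in which
  Newton's identity and the product rule for Omega are later derived.\<close>

lemma fls_exp_eq:
  fixes s :: "qrat mps fps"
  assumes "fps_nth s 0 = 0"
  obtains H where "fls_exp (fps_to_fls s) = fps_to_fls H" "fps_nth H 0 = 1"
    "fps_deriv H = fps_deriv s * H"
proof -
  define c where "c n = mps_const (1 / fact n :: qrat)" for n
  \<comment> \<open>Truncating at n = m is exact, because \<open>s ^ n\<close> starts in degree n or
    later.\<close>
  define H where "H = Abs_fps (\<lambda>m. \<Sum>n\<le>m. c n * fps_nth (s ^ n) m)"
  have zero: "fps_nth (s ^ n) m = 0" if "m < n" for m n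
    using startsby_zero_power_prefix[OF assms, of n] that by simp
  have Hnth: "fps_nth H m = (\<Sum>n<N. c n * fps_nth (s ^ n) m)" if "m < N" for m N
    unfolding H_def fps_nth_Abs_fps
    by (rule sum.mono_neutral_left) (use that zero in auto)
  have "fls_exp (fps_to_fls s) = fps_to_fls H"
    unfolding fls_exp_def
  proof (rule fls_sums_I)
    fix N m assume "m < int N"
    show "(\<Sum>i<N. fls_nth (scal (1 / fact i) * fps_to_fls s ^ i) m) = fls_nth (fps_to_fls H) m"
    proof (cases "m < 0")
      case True
      thus ?thesis by (simp flip: fps_to_fls_power)
    next
      case False
      hence "nat m < N" using \<open>m < int N\<close> by simp
      thus ?thesis using False by (simp add: Hnth c_def flip: fps_to_fls_power)
    qed
  qed
  moreover have "fps_nth H 0 = 1"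
    by (simp add: H_def c_def)
  moreover have "fps_deriv H = fps_deriv s * H"
  proof (rule fps_ext)
    fix m
    \<comment> \<open>As (n+1)/(n+1)! = 1/n!, the derivative of each term of the exponential is s'
      times the preceding one.\<close>
    have c: "c (Suc n) * of_nat (Suc n) = c n" for n
      by (simp add: c_def flip: mps_const_of_nat mps_const_mult del: of_nat_Suc)
    have "fps_nth H (m + 1) = (\<Sum>n<Suc (Suc m). c n * fps_nth (s ^ n) (m + 1))"
      by (rule Hnth) simp
    hence "fps_nth (fps_deriv H) m = of_nat (m + 1) * (\<Sum>n<Suc (Suc m). c n * fps_nth (s ^ n) (m + 1))"
      by (simp only: fps_deriv_nth)
    also have "\<dots> = (\<Sum>n<Suc (Suc m). c n * fps_nth (fps_deriv (s ^ n)) m)"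
      by (simp add: sum_distrib_left mult_ac del: sum.lessThan_Suc)
    also have "\<dots> = (\<Sum>n<Suc m. c (Suc n) * fps_nth (fps_deriv (s ^ Suc n)) m)"
      by (subst sum.lessThan_Suc_shift) simp
    also have "\<dots> = (\<Sum>n<Suc m. c n * fps_nth (fps_deriv s * s ^ n) m)"
    proof (rule sum.cong[OF refl])
      fix n
      have "c (Suc n) * fps_nth (fps_deriv (s ^ Suc n)) m = c (Suc n) * of_nat (Suc n)
          * fps_nth (fps_deriv s * s ^ n) m"
        unfolding fps_deriv_power
        by (simp only: mult.assoc fps_mult_left_const_nth diff_Suc_1)
      thus "c (Suc n) * fps_nth (fps_deriv (s ^ Suc n)) m = c n * fps_nth (fps_deriv s * s ^ n) m"
        by (simp only: c)
    qed
    also have "\<dots> = (\<Sum>i=0..m. \<Sum>n<Suc m. c n * (fps_nth (fps_deriv s) i * fps_nth (s ^ n) (m - i)))"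
      unfolding fps_mult_nth sum_distrib_left by (rule sum.swap)
    also have "\<dots> = (\<Sum>i=0..m. fps_nth (fps_deriv s) i * fps_nth H (m - i))"
      by (intro sum.cong refl) (simp add: Hnth[of _ "Suc m"] sum_distrib_left mult_ac del: sum.lessThan_Suc)
    finally show "fps_nth (fps_deriv H) m = fps_nth (fps_deriv s * H) m"
      by (simp add: fps_mult_nth)
  qed
  ultimately show ?thesis using that by blast
qed

text \<open>The exponent of Omega[-z[u]_t X] is - sum_k p_k[[u]_t] p_k z^k / k; this is minus its
  derivative in z.\<close>

definition beta_series :: "int \<Rightarrow> qrat mps fps" where
  "beta_series u = Abs_fps (\<lambda>j. mps_const (beta_coeff (Suc j) u) * power_sum (Suc j))"

lemma Omega_ex:
  "\<exists>H. Omega (- (fls_X * scal (qint tvar u) * XX)) = fps_to_fls H \<and> fps_nth H 0 = 1 \<and>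
       fps_deriv H = - beta_series u * H"
proof -
  define s where "s = Abs_fps (\<lambda>n. if n = 0 then 0 else - (mps_const (beta_coeff n u / of_nat n)
      * power_sum n))"
  let ?E = "- (fls_X * scal (qint tvar u) * XX)"
  \<comment> \<open>The summand with index k lives in degree k + 1 alone, so each coefficient of the
    infinite sum has at most one contribution.\<close>
  have *: "fls_nth (scal (1 / of_nat (Suc k)) * pk (Suc k) ?E) m =
      (if m = int (Suc k) then fps_nth s (Suc k) else 0)" for k m
    unfolding fls_mult_const_nth pk_minus_zX[OF zero_less_Suc] qrat_subst_beta[OF zero_less_Suc]
    by (simp add: s_def mps_const_mult divide_inverse mult_ac del: of_nat_Suc)
  have "suminf (\<lambda>k. scal (1 / of_nat (Suc k)) * pk (Suc k) ?E) = fps_to_fls s"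
  proof (rule fls_sums_I)
    fix N m assume m: "m < int N"
    show "(\<Sum>i<N. fls_nth (scal (1 / of_nat (Suc i)) * pk (Suc i) ?E) m) = fls_nth (fps_to_fls s) m"
    proof (cases "m \<le> 0")
      case True
      thus ?thesis unfolding * by (auto simp: s_def)
    next
      case False
      hence "(\<Sum>i<N. fls_nth (scal (1 / of_nat (Suc i)) * pk (Suc i) ?E) m) =
         (\<Sum>i<N. if i = nat m - 1 then fps_nth s (nat m) else 0)"
        unfolding * by (intro sum.cong) auto
      also have "\<dots> = fps_nth s (nat m)" using m False by (subst sum.delta) auto
      finally show ?thesis using False by simp
    qed
  qed
  moreover have "fps_deriv s = - beta_series u"
  proof (rule fps_ext)
    fix n
    have "mps_const (beta_coeff (Suc n) u) = mps_const (of_nat (Suc n))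
        * mps_const (beta_coeff (Suc n) u / of_nat (Suc n))"
      by (simp flip: mps_const_mult del: of_nat_Suc)
    thus "fps_nth (fps_deriv s) n = fps_nth (- beta_series u) n"
      by (simp add: s_def beta_series_def mps_const_of_nat mult_ac del: of_nat_Suc)
  qed
  moreover have "fps_nth s 0 = 0" by (simp add: s_def)
  ultimately show ?thesis
    unfolding Omega_def using fls_exp_eq[of s] by metis
qed

definition Omega_series :: "int \<Rightarrow> qrat mps fps" where
  "Omega_series u = (SOME H. Omega (- (fls_X * scal (qint tvar u) * XX)) =
      fps_to_fls H \<and> fps_nth H 0 = 1 \<and>
       fps_deriv H = - beta_series u * H)"

lemma Omega_eq_series: "Omega (- (fls_X * scal (qint tvar u) * XX)) = fps_to_fls (Omega_series u)"
  and Omega_series_0 [simp]: "fps_nth (Omega_series u) 0 = 1"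
  and Omega_series_deriv: "fps_deriv (Omega_series u) = - beta_series u * Omega_series u"
  using someI_ex[OF Omega_ex[of u]] unfolding Omega_series_def by auto

text \<open>Extended by zero to negative indices, since v ranges over all integers and shifted
  indices may become negative.\<close>

definition Omega_coeff :: "int \<Rightarrow> int \<Rightarrow> qrat mps" where
  "Omega_coeff u n = (if n < 0 then 0 else fps_nth (Omega_series u) (nat n))"

text \<open>Newton's identity for the signed elementary symmetric functions of [u]_t X: the
  coefficient of z^(n-1) in the differential equation.\<close>

lemma Omega_series_newton:
  "of_nat n * fps_nth (Omega_series u) n =
     - (\<Sum>j<n. mps_const (beta_coeff (Suc j) u) * power_sum (Suc j)
         * fps_nth (Omega_series u) (n - 1 - j))"
proof (cases n)
  case (Suc m)
  have "of_nat n * fps_nth (Omega_series u) n = fps_nth (fps_deriv (Omega_series u)) m"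
    by (simp add: Suc)
  also have "\<dots> = - (\<Sum>j=0..m. mps_const (beta_coeff (Suc j) u) * power_sum (Suc j)
      * fps_nth (Omega_series u) (m - j))"
    by (simp add: Omega_series_deriv fps_mult_nth beta_series_def flip: sum_negf)
  finally show ?thesis by (simp add: Suc atLeast0AtMost lessThan_Suc_atMost)
qed simp

lemma mps_of_nat_mult_cancel:
  fixes f g :: "qrat mps"
  assumes "of_nat n * f = of_nat n * g" "n > 0"
  shows "f = g"
proof -
  have "f = mps_const (1 / of_nat n * of_nat n) * f" using assms(2) by simp
  also have "\<dots> = mps_const (1 / of_nat n) * (of_nat n * f)"
    unfolding mps_const_mult mps_const_of_nat by (simp add: mult_ac)
  also have "\<dots> = mps_const (1 / of_nat n * of_nat n) * g"
    unfolding assms(1) mps_const_mult mps_const_of_nat by (simp add: mult_ac)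
  finally show ?thesis using assms(2) by simp
qed

lemma PS_uminus: "F \<in> PS \<Longrightarrow> - F \<in> PS"
  using PS_cmult[of F "- 1"] by (simp add: mps_const_uminus)

text \<open>Newton's identity can be solved for the n-th coefficient after division by n. Membership
  in \<open>PS\<close> is what allows a second operator to be applied to these coefficients.\<close>

lemma Omega_series_PS: "fps_nth (Omega_series u) n \<in> PS"
proof (induction n rule: less_induct)
  case (less n)
  show ?case
  proof (cases "n = 0")
    case False
    let ?S = "- (\<Sum>j<n. mps_const (beta_coeff (Suc j) u) * (power_sum (Suc j)
        * fps_nth (Omega_series u) (n - 1 - j)))"
    have "?S \<in> PS"
      by (intro PS_uminus PS_sum PS_cmult PS_times less) auto
    hence "mps_const (1 / of_nat n) * ?S \<in> PS" by (rule PS_cmult)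
    also have "?S = of_nat n * fps_nth (Omega_series u) n" by (simp add: Omega_series_newton mult.assoc)
    also have "mps_const (1 / of_nat n) * (of_nat n * fps_nth (Omega_series u) n) =
        fps_nth (Omega_series u) n"
      using False by (simp add: mult.assoc[symmetric] flip: mps_const_of_nat mps_const_mult)
    finally show ?thesis .
  qed (simp add: PS_1)
qed

lemma Omega_coeff_PS: "Omega_coeff u n \<in> PS"
  by (simp add: Omega_coeff_def PS_0 Omega_series_PS)

section \<open>The operators on the algebra generated by the power sums\<close>

lemma D_add: "F \<in> PS \<Longrightarrow> G \<in> PS \<Longrightarrow> D u v (F + G) = D u v F + D u v G"
  by (simp add: D_def pleth_add distrib_right)

lemma D_cmult: "F \<in> PS \<Longrightarrow> D u v (mps_const c * F) = mps_const c * D u v F"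
  by (simp add: D_def pleth_cmult mult.assoc)

lemma D_const: "D u v (mps_const c) = mps_const c * Omega_coeff u v"
  unfolding D_def pleth_const Omega_eq_series Omega_coeff_def by simp

text \<open>Here p_k[X + M[u]_q/z] = p_k + gamma_k(u) z^-k, and the factor z^-k turns the
  coefficient at v into the one at v + k.\<close>

lemma D_power_sum_times:
  assumes "F \<in> PS" "k > 0"
  shows "D u v (power_sum k * F) = power_sum k * D u v F + mps_const (gamma_coeff k u) * D u (v
      + int k) F"
proof -
  have *: "fls_nth ((fls_const p + fls_const g * fls_X_inv ^ k) * P * W) v =
      p * fls_nth (P * W) v + g * fls_nth (P * W) (v + int k)" for p g and P W :: expr
  proof -
    have "(fls_const p + fls_const g * fls_X_inv ^ k) * P * W =
        fls_const p * (P * W) + fls_const g * (fls_X_inv ^ k * (P * W))"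
      by (simp add: algebra_simps)
    thus ?thesis
      by (simp only: fls_X_inv_power_times_conv_shift fls_plus_nth fls_mult_const_nth fls_shift_nth)
  qed
  show ?thesis
    unfolding D_def pleth_power_sum_times[OF assms] pk_X_plus[OF assms(2)]
      qrat_subst_gamma[OF assms(2)] by (rule *)
qed

lemma D_PS: "F \<in> PS \<Longrightarrow> D u v F \<in> PS"
proof (induction arbitrary: v rule: PS.induct)
  case (PS_const c)
  show ?case by (simp add: D_const PS_cmult Omega_coeff_PS)
next
  case (PS_times k F)
  thus ?case by (simp add: D_power_sum_times PS_add PS.PS_times PS_cmult)
next
  case (PS_add F G)
  thus ?case by (simp add: D_add PS.PS_add)
qed

lemma D_0 [simp]: "D u v 0 = 0"
  using D_const[of u v 0] by simp

lemma D_uminus: "F \<in> PS \<Longrightarrow> D u v (- F) = - D u v F"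
  using D_cmult[of F u v "-1"] by (simp add: mps_const_uminus)

lemma D_sum: "(\<And>i. i \<in> A \<Longrightarrow> f i \<in> PS) \<Longrightarrow> D u v (\<Sum>i\<in>A. f i) = (\<Sum>i\<in>A. D u v (f i))"
  by (induction A rule: infinite_finite_induct) (auto simp: D_add PS_sum)

section \<open>The commutator\<close>

text \<open>
  The coefficients of the rational function \<open>(1 - s)(1 - xys) / ((1 - xs)(1 - ys))\<close>, in partial
  fractions. The recurrence below is its logarithmic derivative.
\<close>

definition kernel_coeff :: "qrat \<Rightarrow> qrat \<Rightarrow> nat \<Rightarrow> qrat" where
  "kernel_coeff x y n = (if n = 0 then 1 else (x - 1) * (1 - y) / (x - y) * (x ^ n - y ^ n))"

lemma kernel_coeff_rec:
  assumes "x \<noteq> y"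
  shows "of_nat n * kernel_coeff x y n =
    - (\<Sum>j<n. (1 - x ^ Suc j) * (1 - y ^ Suc j) * kernel_coeff x y (n - 1 - j))"
proof (cases n)
  case (Suc m)
  define A where "A = (x - 1) * (1 - y) / (x - y)"
  have A: "A * (x - y) = (x - 1) * (1 - y)" using assms by (simp add: A_def)
  \<comment> \<open>\<open>geo c\<close> is 1/(1 - cs) and \<open>li c\<close> is 1 - cs;
    multiplying by \<open>geo\<close> replaces division.\<close>
  define geo where "geo c = Abs_fps (\<lambda>n. c ^ n)" for c :: qrat
  define li where "li c = 1 - fps_const c * fps_X" for c :: qrat
  have geo: "geo c * li c = 1" for c
    by (rule fps_ext) (auto simp: geo_def li_def algebra_simps power_eq_if)
  have li': "fps_deriv (li c) = - fps_const c" for c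
    by (simp add: li_def)
  define f where "f = Abs_fps (kernel_coeff x y)"
  \<comment> \<open>Minus the logarithmic derivative of (1 - s)(1 - xys) / ((1 - xs)(1 -
    ys)).\<close>
  define L where "L = geo 1 - fps_const x * geo x - fps_const y * geo y + fps_const (x * y) * geo (x
      * y)"
  have f_eq: "f = 1 + fps_const A * (geo x - geo y)"
    by (rule fps_ext) (auto simp: f_def kernel_coeff_def A_def geo_def)
  have "f * li x * li y = li x * li y + fps_const A * ((geo x * li x) * li y - (geo y * li y) * li x)"
    by (simp add: f_eq algebra_simps)
  also have "\<dots> = li x * li y + fps_const (A * (x - y)) * fps_X"
    unfolding geo by (simp add: li_def algebra_simps flip: fps_const_mult fps_const_sub)
  also have "\<dots> = li 1 * li (x * y)"
    unfolding A by (simp add: li_def algebra_simps flip: fps_const_mult fps_const_sub)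
  finally have ff: "f * li x * li y = li 1 * li (x * y)" .
  have "fps_deriv (f * li x * li y) = fps_deriv (li 1 * li (x * y))" by (simp only: ff)
  hence d: "fps_deriv f * li x * li y = f * (fps_const x * li y + fps_const y * li x)
       - li (x * y) - fps_const (x * y) * li 1"
    unfolding fps_deriv_mult li' by (simp add: algebra_simps del: fps_const_neg)
  have "fps_deriv f = fps_deriv f * (geo x * li x) * (geo y * li y)"
    by (simp add: geo)
  also have "\<dots> = (fps_deriv f * li x * li y) * (geo x * geo y)"
    by (simp add: mult_ac)
  also have "\<dots> = f * fps_const x * geo x * (geo y * li y) + f * fps_const y * geo y * (geo x * li x)
     - li (x * y) * (geo x * geo y) - fps_const (x * y) * li 1 * (geo x * geo y)"
    unfolding d by (simp add: algebra_simps)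
  also have "\<dots> = f * fps_const x * geo x + f * fps_const y * geo y
     - (geo 1 * li 1) * li (x * y) * (geo x * geo y)
     - fps_const (x * y) * (geo (x * y) * li (x * y)) * li 1 * (geo x * geo y)"
    by (simp only: geo mult_1 mult_1_right)
  also have "\<dots> = f * fps_const x * geo x + f * fps_const y * geo y -
     (geo 1 + fps_const (x * y) * geo (x * y)) * (li 1 * li (x * y)) * (geo x * geo y)"
    by (simp add: algebra_simps)
  also have "\<dots> = f * fps_const x * geo x + f * fps_const y * geo y -
     (geo 1 + fps_const (x * y) * geo (x * y)) * f * (geo x * li x) * (geo y * li y)"
    unfolding ff[symmetric] by (simp add: mult_ac)
  also have "\<dots> = - (L * f)"
    unfolding geo L_def by (simp add: algebra_simps)
  finally have deriv: "fps_deriv f = - (L * f)" .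
  have "fps_nth L j = (1 - x ^ Suc j) * (1 - y ^ Suc j)" for j
    by (simp add: L_def geo_def algebra_simps power_mult_distrib)
  moreover have "of_nat n * kernel_coeff x y n = fps_nth (fps_deriv f) m"
    by (simp add: Suc f_def)
  ultimately show ?thesis
    unfolding deriv
    by (simp add: Suc f_def fps_mult_nth atLeast0AtMost lessThan_Suc_atMost)
qed simp

lemma sum_triangle_swap:
  fixes g :: "nat \<Rightarrow> nat \<Rightarrow> 'a::comm_monoid_add"
  shows "(\<Sum>j<b. \<Sum>n\<le>b - 1 - j. g j n) = (\<Sum>n<b. \<Sum>j<b - n. g j n)"
  unfolding sum.Sigma[OF finite_lessThan ballI[OF finite_atMost]] sum.Sigma[OF finite_lessThan ballI[OF finite_lessThan]]
  by (rule sum.reindex_bij_witness[where i = "\<lambda>(n, j). (j, n)" and j = "\<lambda>(j, n). (n, j)"]) auto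

text \<open>Collects the terms with j + 1 + n = N. The inner sum for N = 0 is empty, so N may run
  over all of 0..b.\<close>

lemma sum_triangle_diag:
  fixes g :: "nat \<Rightarrow> nat \<Rightarrow> 'a::comm_monoid_add"
  shows "(\<Sum>j<b. \<Sum>n\<le>b - 1 - j. g j n) = (\<Sum>N\<le>b. \<Sum>j<N. g j (N - 1 - j))"
  unfolding sum.Sigma[OF finite_lessThan ballI[OF finite_atMost]] sum.Sigma[OF finite_atMost ballI[OF finite_lessThan]]
  by (rule sum.reindex_bij_witness[where i = "\<lambda>(N, j). (j, N - 1 - j)" and j = "\<lambda>(j, n). (j + n
      + 1, j)"]) auto

text \<open>The factor 1 - q^-k of gamma cancels the denominator of beta. This is the origin of x =
  q^-a and y = q^c in the kernel.\<close>

lemma beta_times_gamma: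
  assumes "k > 0"
  shows "beta_coeff k a * gamma_coeff k c = (1 - (qvar powi (- a)) ^ k) * (1 - (qvar powi c) ^ k)"
proof -
  have "inverse (qvar ^ k) \<noteq> 1"
    using qvar_power_neq_1[OF assms] by (metis inverse_eq_1_iff)
  moreover have "qvar powi (- int k * a) = (qvar powi (- a)) ^ k" "qvar powi (int k * c) =
      (qvar powi c) ^ k"
    by (simp_all add: mult.commute flip: power_int_mult power_int_of_nat)
  ultimately show ?thesis by (simp add: beta_coeff_def gamma_coeff_def)
qed

text \<open>Newton's identity expands b h_b, and each p_k is moved past D. In the terms that keep
  p_k, Newton's identity used backwards produces the weight b - n; in the gamma terms the kernel
  recurrence produces the weight n. The weights add up to b, which is cancelled.\<close>

lemma D_Omega_series:
  assumes "a + c \<noteq> 0"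
  shows "D c d (fps_nth (Omega_series a) b) =
    (\<Sum>n\<le>b. mps_const (kernel_coeff (qvar powi (- a)) (qvar powi c) n)
        * fps_nth (Omega_series a) (b - n) * Omega_coeff c (d + int n))"
proof (induction b arbitrary: d rule: less_induct)
  case (less b)
  define x y where "x = qvar powi (- a)" and "y = qvar powi c"
  have "x \<noteq> y"
  proof
    assume "x = y"
    hence "qvar powi a * qvar powi (- a) = qvar powi a * qvar powi c" by (simp add: x_def y_def)
    hence "qvar powi (a + c) = 1" using qvar_nonzero by (simp flip: power_int_add)
    thus False using qvar_power_int_neq_1 assms by blast
  qed
  define f where "f n = mps_const (kernel_coeff x y n)" for n
  define be where "be j = mps_const (beta_coeff (Suc j) a)" for j
  define ga where "ga j = mps_const (gamma_coeff (Suc j) c)" for j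
  define h where "h = fps_nth (Omega_series a)"
  define p where "p j = power_sum (Suc j)" for j
  have f_rec: "(\<Sum>j<n. be j * ga j * f (n - 1 - j)) = - (of_nat n * f n)" for n
  proof -
    have "mps_const (of_nat n * kernel_coeff x y n) =
        mps_const (- (\<Sum>j<n. (1 - x ^ Suc j) * (1 - y ^ Suc j) * kernel_coeff x y (n - 1 - j)))"
      by (simp only: kernel_coeff_rec[OF \<open>x \<noteq> y\<close>])
    also have "\<dots> = - (\<Sum>j<n. mps_const ((1 - x ^ Suc j) * (1 - y ^ Suc j)
        * kernel_coeff x y (n - 1 - j)))"
      unfolding mps_const_uminus
      by (rule arg_cong[where f = uminus], rule mps_const_sum)
    also have "\<dots> = - (\<Sum>j<n. be j * ga j * f (n - 1 - j))"
      by (simp only: be_def ga_def f_def beta_times_gamma[OF zero_less_Suc] x_def y_def flip: mps_const_mult)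
    finally show ?thesis
      by (simp add: f_def mps_const_mult mps_const_of_nat)
  qed
  have newton: "(\<Sum>j<n. be j * p j * h (n - 1 - j)) = - (of_nat n * h n)" for n
    unfolding h_def be_def p_def by (simp add: Omega_series_newton)
  show ?case
  proof (cases "b = 0")
    case True
    thus ?thesis using D_const[of c d 1] by (simp add: kernel_coeff_def)
  next
    case False
    have IH: "D c d (h k) = (\<Sum>n\<le>k. f n * h (k - n) * Omega_coeff c (d + int n))" if "k < b" for k d
      using less.IH[OF that] by (simp add: h_def f_def x_def y_def)
    have hPS: "h k \<in> PS" for k by (simp add: h_def Omega_series_PS)
    have pPS: "p j * h k \<in> PS" for j k unfolding p_def by (intro PS_times hPS) simp
    have "of_nat b * D c d (h b) = D c d (of_nat b * h b)"
      using D_cmult[OF hPS, of c d "of_nat b"] by (simp add: mps_const_of_nat)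
    also have "of_nat b * h b = - (\<Sum>j<b. be j * (p j * h (b - 1 - j)))"
      using newton[of b] by (simp add: mult.assoc)
    also have "D c d \<dots> = - (\<Sum>j<b. be j * D c d (p j * h (b - 1 - j)))"
      unfolding be_def by (subst D_uminus, intro PS_sum PS_cmult pPS, subst D_sum)
        (auto intro!: PS_cmult pPS simp: D_cmult pPS)
    also have "\<dots> = - (\<Sum>j<b. be j * (p j * D c d (h (b - 1 - j)) + ga j * D c (d
        + int (Suc j)) (h (b - 1 - j))))"
      unfolding p_def ga_def by (simp only: D_power_sum_times[OF hPS zero_less_Suc])
    also have "\<dots> = - (\<Sum>j<b. \<Sum>n\<le>b - 1 - j. be j * p j * h (b - 1 - j - n) * (f n * Omega_coeff c (d
        + int n)))
       - (\<Sum>j<b. \<Sum>n\<le>b - 1 - j. be j * ga j * f n * (h (b - 1 - j - n) * Omega_coeff c (d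
           + int (Suc j) + int n)))"
      by (simp add: IH sum.distrib algebra_simps sum_distrib_left sum_negf)
    also have "(\<Sum>j<b. \<Sum>n\<le>b - 1 - j. be j * p j * h (b - 1 - j - n) * (f n * Omega_coeff c (d + int n))) =
        (\<Sum>n<b. \<Sum>j<b - n. be j * p j * h (b - n - 1 - j) * (f n * Omega_coeff c (d + int n)))"
      unfolding sum_triangle_swap by (intro sum.cong refl) (simp add: add.commute)
    also have "\<dots> = - (\<Sum>n<b. of_nat (b - n) * h (b - n) * (f n * Omega_coeff c (d + int n)))"
      unfolding sum_distrib_right[symmetric] newton by (simp add: sum_negf)
    \<comment> \<open>The added term n = b has weight b - n = 0; with it, both sums have the same
      range.\<close>
    also have "\<dots> = - (\<Sum>n\<le>b. of_nat (b - n) * h (b - n) * (f n * Omega_coeff c (d + int n)))"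
      by (simp flip: lessThan_Suc_atMost)
    also have "(\<Sum>j<b. \<Sum>n\<le>b - 1 - j. be j * ga j * f n * (h (b - 1 - j - n) * Omega_coeff c (d
        + int (Suc j) + int n))) =
       (\<Sum>N\<le>b. \<Sum>j<N. be j * ga j * f (N - 1 - j) * (h (b - N) * Omega_coeff c (d + int N)))"
      unfolding sum_triangle_diag
      by (intro sum.cong refl) (auto simp: algebra_simps of_nat_diff intro!: arg_cong2[where f =
          "(*)"] arg_cong[where f = "Omega_coeff c"] arg_cong[where f = h])
    also have "\<dots> = - (\<Sum>n\<le>b. of_nat n * f n * (h (b - n) * Omega_coeff c (d + int n)))"
      unfolding sum_distrib_right[symmetric] f_rec by (simp add: sum_negf)
    also have "- (- (\<Sum>n\<le>b. of_nat (b - n) * h (b - n) * (f n * Omega_coeff c (d + int n)))) -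
        - (\<Sum>n\<le>b. of_nat n * f n * (h (b - n) * Omega_coeff c (d + int n))) =
        (\<Sum>n\<le>b. of_nat (b - n) * h (b - n) * (f n * Omega_coeff c (d + int n)) + of_nat n * f n
            * (h (b - n) * Omega_coeff c (d + int n)))"
      by (simp add: sum.distrib)
    also have "\<dots> = (\<Sum>n\<le>b. of_nat b * (f n * h (b - n) * Omega_coeff c (d + int n)))"
      by (intro sum.cong refl) (auto simp: algebra_simps of_nat_diff)
    finally have "of_nat b * D c d (h b) = of_nat b * (\<Sum>n\<le>b. f n * h (b - n) * Omega_coeff c (d
        + int n))"
      by (simp add: sum_distrib_left)
    hence "D c d (h b) = (\<Sum>n\<le>b. f n * h (b - n) * Omega_coeff c (d + int n))"
      by (rule mps_of_nat_mult_cancel) (use False in simp)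
    thus ?thesis by (simp add: h_def f_def x_def y_def)
  qed
qed

text \<open>Indexing by i = b - n over 0..b+d gives a range symmetric in b and d, so that the two
  compositions in the commutator can be subtracted term by term.\<close>

lemma D_Omega_coeff:
  assumes "a + c \<noteq> 0"
  shows "D c d (Omega_coeff a b) = (\<Sum>i\<in>{0..b + d}.
    mps_const (if i \<le> b then kernel_coeff (qvar powi (- a)) (qvar powi c) (nat (b - i)) else 0)
        * Omega_coeff a i * Omega_coeff c (b + d - i))"
    (is "_ = sum ?g _")
proof (cases "b < 0")
  case True
  hence "Omega_coeff a b = 0" by (simp add: Omega_coeff_def)
  moreover have "sum ?g {0..b + d} = 0" using True by (intro sum.neutral) auto
  ultimately show ?thesis by simp
next
  case False
  have "D c d (Omega_coeff a b) = D c d (fps_nth (Omega_series a) (nat b))" using False by (simp add: Omega_coeff_def)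
  also have "\<dots> = (\<Sum>n\<le>nat b. ?g (b - int n))"
    unfolding D_Omega_series[OF assms] using False
    by (intro sum.cong) (auto simp: Omega_coeff_def nat_diff_distrib' algebra_simps)
  also have "\<dots> = (\<Sum>i\<in>{0..b}. ?g i)"
    using False by (intro sum.reindex_bij_witness[where i = "\<lambda>i. nat (b - i)" and j =
        "\<lambda>n. b - int n"]) auto
  \<comment> \<open>The larger range contains both others: terms with i > b vanish by the
    conditional, terms with i > b + d by the negative index.\<close>
  also have "\<dots> = (\<Sum>i\<in>{0..max b (b + d)}. ?g i)"
    by (intro sum.mono_neutral_left) auto
  also have "\<dots> = (\<Sum>i\<in>{0..b + d}. ?g i)"
    by (intro sum.mono_neutral_right) (auto simp: Omega_coeff_def)
  finally show ?thesis .
qed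

section \<open>Products of Omega series\<close>

lemma fps_linear_ode_unique:
  fixes Y Z g :: "qrat mps fps"
  assumes "fps_deriv Y = g * Y" "fps_deriv Z = g * Z" "fps_nth Y 0 = fps_nth Z 0"
  shows "Y = Z"
proof -
  have "fps_nth Y n = fps_nth Z n" for n
  proof (induction n rule: less_induct)
    case (less n)
    show ?case
    proof (cases n)
      case (Suc m)
      have "of_nat n * fps_nth Y n = fps_nth (g * Y) m"
        using arg_cong[OF assms(1), of "\<lambda>F. fps_nth F m"] by (simp add: Suc)
      also have "\<dots> = fps_nth (g * Z) m"
        unfolding fps_mult_nth by (intro sum.cong refl) (simp add: less Suc)
      also have "\<dots> = of_nat n * fps_nth Z n"
        using arg_cong[OF assms(2), of "\<lambda>F. fps_nth F m"] by (simp add: Suc)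
      finally show ?thesis by (rule mps_of_nat_mult_cancel) (simp add: Suc)
    qed (simp add: assms(3))
  qed
  thus ?thesis by (rule fps_ext)
qed

text \<open>The substitution z -> rz. It absorbs the powers r^i that occur in the
  convolutions.\<close>

definition scale_z :: "qrat \<Rightarrow> qrat mps fps \<Rightarrow> qrat mps fps" where
  "scale_z r F = Abs_fps (\<lambda>n. mps_const (r ^ n) * fps_nth F n)"

lemma scale_z_mult: "scale_z r (F * G) = scale_z r F * scale_z r G"
proof (rule fps_ext)
  fix n
  have "mps_const (r ^ n) * (fps_nth F i * fps_nth G (n - i)) =
    mps_const (r ^ i) * fps_nth F i * (mps_const (r ^ (n - i)) * fps_nth G (n - i))" if "i \<in> {0..n}"
        for i
  proof -
    have "mps_const (r ^ n) = mps_const (r ^ i) * mps_const (r ^ (n - i))"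
      using that by (simp flip: mps_const_mult power_add)
    thus ?thesis by (simp add: mult_ac)
  qed
  thus "fps_nth (scale_z r (F * G)) n = fps_nth (scale_z r F * scale_z r G) n"
    by (simp add: scale_z_def fps_mult_nth sum_distrib_left)
qed

lemma scale_z_uminus: "scale_z r (- F) = - scale_z r F"
  by (rule fps_ext) (simp add: scale_z_def)

lemma scale_z_deriv: "fps_deriv (scale_z r F) = fps_const (mps_const r) * scale_z r (fps_deriv F)"
  by (rule fps_ext) (simp add: scale_z_def mps_const_mult mult_ac)

lemma scale_z_Omega_series_deriv:
  "fps_deriv (scale_z r (Omega_series u)) = - (fps_const (mps_const r) * scale_z r (beta_series u))
      * scale_z r (Omega_series u)"
  by (simp add: scale_z_deriv Omega_series_deriv scale_z_mult scale_z_uminus mult_ac)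

lemma beta_coeff_powi:
  "beta_coeff k a = (1 - inverse ((qvar powi a) ^ k)) / (1 - inverse (qvar ^ k))"
  "beta_coeff k (a + c) = (1 - inverse ((qvar powi a) ^ k)
      * inverse ((qvar powi c) ^ k)) / (1 - inverse (qvar ^ k))"
proof -
  have *: "qvar powi (- int k * a) = inverse ((qvar powi a) ^ k)" for a
    by (simp add: mult.commute power_int_minus power_int_mult)
  show "beta_coeff k a = (1 - inverse ((qvar powi a) ^ k)) / (1 - inverse (qvar ^ k))" for a
    by (simp only: beta_coeff_def *)
  show "beta_coeff k (a + c) = (1 - inverse ((qvar powi a) ^ k)
      * inverse ((qvar powi c) ^ k)) / (1 - inverse (qvar ^ k))"
    using qvar_nonzero by (simp add: beta_coeff_def
        * power_int_add power_mult_distrib del: mult_minus_left)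
qed

text \<open>Because q^a [a]_t + [c]_t = q^a [a+c]_t, also after q -> q^k, both sides solve the same
  differential equation.\<close>

lemma Omega_series_conv_left: "scale_z (qvar powi a) (Omega_series a) * Omega_series c =
    scale_z (qvar powi a) (Omega_series (a + c))"
proof (rule fps_linear_ode_unique)
  let ?r = "qvar powi a"
  let ?K = "fps_const (mps_const ?r)"
  have "?K * scale_z ?r (beta_series a) + beta_series c = ?K * scale_z ?r (beta_series (a + c))"
  proof (rule fps_ext)
    fix n
    have "?r ^ Suc n * beta_coeff (Suc n) a + beta_coeff (Suc n) c = ?r ^ Suc n
        * beta_coeff (Suc n) (a + c)"
    proof -
      define P Q where "P = ?r ^ Suc n" and "Q = (qvar powi c) ^ Suc n"
      have "P * (1 - inverse P) + (1 - inverse Q) = P * (1 - inverse P * inverse Q)"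
        using qvar_nonzero by (simp add: P_def Q_def field_simps del: power_Suc)
      thus ?thesis
        unfolding beta_coeff_powi(2) unfolding beta_coeff_powi(1) P_def[symmetric] Q_def[symmetric]
        by (simp only: times_divide_eq_right flip: add_divide_distrib)
    qed
    hence "mps_const (?r ^ Suc n * beta_coeff (Suc n) a + beta_coeff (Suc n) c) * power_sum (Suc n) =
        mps_const (?r ^ Suc n * beta_coeff (Suc n) (a + c)) * power_sum (Suc n)"
      by simp
    thus "fps_nth (?K * scale_z ?r (beta_series a) + beta_series c) n = fps_nth (?K
        * scale_z ?r (beta_series (a + c))) n"
      by (simp add: scale_z_def beta_series_def mps_const_add mps_const_mult algebra_simps)
  qed
  note B = this
  show "fps_deriv (scale_z ?r (Omega_series (a + c))) = - (?K * scale_z ?r (beta_series (a + c)))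
      * scale_z ?r (Omega_series (a + c))"
    by (rule scale_z_Omega_series_deriv)
  show "fps_deriv (scale_z ?r (Omega_series a) * Omega_series c) = - (?K
      * scale_z ?r (beta_series (a + c))) * (scale_z ?r (Omega_series a) * Omega_series c)"
    unfolding B[symmetric] by (simp add: scale_z_Omega_series_deriv Omega_series_deriv algebra_simps)
qed (simp add: scale_z_def)

text \<open>The same argument with q^-c [a]_t + [c]_t = [a+c]_t.\<close>

lemma Omega_series_conv_right: "scale_z (qvar powi (- c)) (Omega_series a) * Omega_series c =
    Omega_series (a + c)"
proof (rule fps_linear_ode_unique)
  let ?r = "qvar powi (- c)"
  let ?K = "fps_const (mps_const ?r)"
  have "?K * scale_z ?r (beta_series a) + beta_series c = beta_series (a + c)"
  proof (rule fps_ext)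
    fix n
    have "?r ^ Suc n * beta_coeff (Suc n) a + beta_coeff (Suc n) c = beta_coeff (Suc n) (a + c)"
    proof -
      define P Q where "P = (qvar powi a) ^ Suc n" and "Q = (qvar powi c) ^ Suc n"
      have "inverse Q * (1 - inverse P) + (1 - inverse Q) = 1 - inverse P * inverse Q"
        by (simp add: algebra_simps)
      thus ?thesis
        unfolding beta_coeff_powi(2) unfolding beta_coeff_powi(1)
            power_int_minus power_inverse P_def[symmetric] Q_def[symmetric]
        by (simp only: times_divide_eq_right flip: add_divide_distrib)
    qed
    hence "mps_const (?r ^ Suc n * beta_coeff (Suc n) a + beta_coeff (Suc n) c) * power_sum (Suc n) =
        mps_const (beta_coeff (Suc n) (a + c)) * power_sum (Suc n)"
      by simp
    thus "fps_nth (?K * scale_z ?r (beta_series a) + beta_series c) n = fps_nth (beta_series (a + c)) n"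
      by (simp add: scale_z_def beta_series_def mps_const_add mps_const_mult algebra_simps)
  qed
  note B = this
  show "fps_deriv (Omega_series (a + c)) = - beta_series (a + c) * Omega_series (a + c)"
    by (rule Omega_series_deriv)
  show "fps_deriv (scale_z ?r (Omega_series a) * Omega_series c) = - beta_series (a + c)
      * (scale_z ?r (Omega_series a) * Omega_series c)"
    unfolding B[symmetric] by (simp add: scale_z_Omega_series_deriv Omega_series_deriv algebra_simps)
qed (simp add: scale_z_def)

lemma Omega_coeff_conv:
  assumes "scale_z r (Omega_series a) * Omega_series c = G" "r \<noteq> 0"
  shows "(\<Sum>i\<in>{0..v}. mps_const (r powi i) * Omega_coeff a i * Omega_coeff c (v - i)) =
      (if v < 0 then 0 else fps_nth G (nat v))"
proof (cases "v < 0")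
  case False
  have "(\<Sum>i\<in>{0..v}. mps_const (r powi i) * Omega_coeff a i * Omega_coeff c (v - i)) =
     (\<Sum>i\<in>{0..nat v}. mps_const (r ^ i) * fps_nth (Omega_series a) i
         * fps_nth (Omega_series c) (nat v - i))"
    using False
    by (intro sum.reindex_bij_witness[where i = int and j = nat])
       (auto simp: Omega_coeff_def nat_diff_distrib' power_int_def)
  also have "\<dots> = fps_nth G (nat v)"
    by (simp add: scale_z_def fps_mult_nth flip: assms(1))
  finally show ?thesis using False by simp
qed simp

text \<open>M times the scalar of the theorem, in the shape the two convolutions produce.\<close>

definition comm_coeff :: "int \<Rightarrow> int \<Rightarrow> int \<Rightarrow> int \<Rightarrow> qrat" where
  "comm_coeff a b c d = (1 - qvar powi a) * (1 - qvar powi c) / (1 - qvar powi (a + c)) *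
     (qvar powi (a * d) - qvar powi (b * c))"

lemma commutator_one:
  assumes "a + c \<noteq> 0"
  shows "D c d (Omega_coeff a b) - D a b (Omega_coeff c d) = mps_const (comm_coeff a b c d)
      * Omega_coeff (a + c) (b + d)"
proof -
  define x y where "x = qvar powi (- a)" and "y = qvar powi c"
  define A where "A = (x - 1) * (1 - y) / (x - y)"
  have A: "A = (1 - qvar powi a) * (1 - qvar powi c) / (1 - qvar powi (a + c))"
  proof -
    define r where "r = qvar powi a"
    have r: "r \<noteq> 0" "x = inverse r" "qvar powi (a + c) = r * y"
      using qvar_nonzero by (auto simp: r_def x_def y_def power_int_minus power_int_add)
    have "1 - r * y \<noteq> 0" using qvar_power_int_neq_1[OF assms] r by simp
    moreover from this have "inverse r - y \<noteq> 0" using r by (auto simp: field_simps)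
    ultimately show ?thesis
      unfolding A_def r(3) r_def[symmetric] y_def[symmetric] r(2) using r(1)
      by (simp add: divide_eq_eq eq_divide_eq) (simp add: field_simps)
  qed
  have "x \<noteq> y"
  proof
    assume "x = y"
    hence "qvar powi a * x = qvar powi a * y" by simp
    hence "qvar powi (a + c) = 1"
      using qvar_nonzero by (simp add: x_def y_def flip: power_int_add)
    thus False using qvar_power_int_neq_1 assms by blast
  qed
  have xy: "x \<noteq> 0" "y \<noteq> 0" using qvar_nonzero by (auto simp: x_def y_def)
  let ?v = "b + d"
  have "D a b (Omega_coeff c d) = (\<Sum>i\<in>{0..?v}.
     mps_const (if i \<le> d then kernel_coeff (qvar powi (- c)) (qvar powi a) (nat (d - i)) else 0)
         * Omega_coeff c i * Omega_coeff a (d + b - i))"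
    using D_Omega_coeff[of c a b d] assms by (simp add: add.commute)
  \<comment> \<open>Reversing i -> b + d - i aligns this sum with the other composition. Exchanging
    (a,b) with (c,d) replaces (x,y) by (1/y, 1/x).\<close>
  also have "\<dots> = (\<Sum>i\<in>{0..?v}.
     mps_const (if b \<le> i then kernel_coeff (inverse y) (inverse x) (nat (i - b)) else 0)
         * Omega_coeff a i * Omega_coeff c (?v - i))"
    by (rule sum.reindex_bij_witness[where i = "\<lambda>i. ?v - i" and j = "\<lambda>i. ?v - i"])
       (auto simp: x_def y_def power_int_minus algebra_simps)
  finally have 2: "D a b (Omega_coeff c d) = \<dots>" .
  have 1: "D c d (Omega_coeff a b) = (\<Sum>i\<in>{0..?v}.
     mps_const (if i \<le> b then kernel_coeff x y (nat (b - i)) else 0) * Omega_coeff a i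
         * Omega_coeff c (?v - i))"
    unfolding x_def y_def by (rule D_Omega_coeff[OF assms])
  \<comment> \<open>The two one-sided kernels join into one formula for all i: the constant A is
    invariant under (x,y) -> (1/y, 1/x), and at i = b both kernels are 1 and cancel, in accordance
    with x^0 - y^0 = 0.\<close>
  have coef: "(if i \<le> b then kernel_coeff x y (nat (b - i)) else 0)
      - (if b \<le> i then kernel_coeff (inverse y) (inverse x) (nat (i - b)) else 0)
     = A * (x powi (b - i) - y powi (b - i))" for i
  proof -
    have A': "(inverse y - 1) * (1 - inverse x) / (inverse y - inverse x) = A"
      using xy \<open>x \<noteq> y\<close> by (simp add: A_def divide_eq_eq eq_divide_eq) (simp add: field_simps)
    consider "i < b" | "i = b" | "b < i" by linarith
    thus ?thesis
    proof cases
      case 1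
      thus ?thesis by (simp add: kernel_coeff_def A_def power_int_def)
    next
      case 3
      thus ?thesis using A' by (simp add: kernel_coeff_def power_int_def right_diff_distrib)
    qed (simp add: kernel_coeff_def)
  qed
  have "D c d (Omega_coeff a b) - D a b (Omega_coeff c d) =
     (\<Sum>i\<in>{0..?v}. mps_const (A * (x powi (b - i) - y powi (b - i))) * Omega_coeff a i
         * Omega_coeff c (?v - i))"
    unfolding 1 2 sum_subtractf[symmetric] coef[symmetric] mps_const_diff
    by (intro sum.cong refl) (simp only: left_diff_distrib)
  also have "\<dots> = (\<Sum>i\<in>{0..?v}. mps_const (A * x powi b) * (mps_const ((qvar powi a) powi i)
      * Omega_coeff a i * Omega_coeff c (?v - i))
     - mps_const (A * y powi b) * (mps_const ((qvar powi (- c)) powi i) * Omega_coeff a i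
         * Omega_coeff c (?v - i)))"
  proof (intro sum.cong refl)
    fix i
    \<comment> \<open>Since x^-i = (q^a)^i and y^-i = (q^-c)^i, the two resulting sums are exactly
      the left and the right convolution.\<close>
    have "A * (x powi (b - i) - y powi (b - i)) = (A * x powi b) * (qvar powi a) powi i - (A
        * y powi b) * (qvar powi (- c)) powi i"
      using xy qvar_nonzero by (simp add: x_def y_def power_int_diff power_int_minus field_simps)
    thus "mps_const (A * (x powi (b - i) - y powi (b - i))) * Omega_coeff a i * Omega_coeff c (?v - i) =
       mps_const (A * x powi b) * (mps_const ((qvar powi a) powi i) * Omega_coeff a i
           * Omega_coeff c (?v - i))
     - mps_const (A * y powi b) * (mps_const ((qvar powi (- c)) powi i) * Omega_coeff a i
         * Omega_coeff c (?v - i))"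
      by (simp only: mps_const_diff mps_const_mult) (simp add: algebra_simps)
  qed
  also have "\<dots> = mps_const (A * x powi b) * (if ?v < 0 then 0
      else fps_nth (scale_z (qvar powi a) (Omega_series (a + c))) (nat ?v))
     - mps_const (A * y powi b) * (if ?v < 0 then 0 else fps_nth (Omega_series (a + c)) (nat ?v))"
    unfolding sum_subtractf sum_distrib_left[symmetric]
    using Omega_coeff_conv[OF Omega_series_conv_left] Omega_coeff_conv[OF Omega_series_conv_right] qvar_nonzero by simp
  also have "\<dots> = mps_const (A * x powi b * (qvar powi a) powi ?v - A * y powi b) * Omega_coeff (a
      + c) ?v"
    by (simp add: Omega_coeff_def scale_z_def mps_const_diff mps_const_mult algebra_simps power_int_def)
  also have "A * x powi b * (qvar powi a) powi ?v - A * y powi b = comm_coeff a b c d"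
  proof -
    have "x powi b * (qvar powi a) powi ?v = qvar powi (a * d)"
      using qvar_nonzero unfolding x_def power_int_mult[symmetric]
      by (simp add: algebra_simps flip: power_int_add)
    moreover have "y powi b = qvar powi (b * c)"
      unfolding y_def power_int_mult[symmetric] by (simp add: mult.commute)
    ultimately show ?thesis unfolding comm_coeff_def A[symmetric] by (simp add: algebra_simps)
  qed
  finally show ?thesis .
qed

text \<open>The compatibility that carries the induction: after removing common factors it is a
  polynomial identity in P, Q, R, S.\<close>

lemma comm_coeff_rec:
  assumes "a + c \<noteq> 0"
  shows "gamma_coeff k c * comm_coeff a b c (d + int k) + gamma_coeff k a * comm_coeff a (b
      + int k) c d = comm_coeff a b c d * gamma_coeff k (a + c)"
proof -
  define g C where "g = 1 - inverse (qvar ^ k)"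
    and "C = (1 - qvar powi a) * (1 - qvar powi c) / (1 - qvar powi (a + c))"
  define P Q R S where "P = qvar powi (int k * a)" and "Q = qvar powi (int k * c)"
    and "R = qvar powi (a * d)" and "S = qvar powi (b * c)"
  have 1: "qvar powi (a * (d + int k)) = P * R" "qvar powi ((b + int k) * c) = S * Q"
    "qvar powi (int k * (a + c)) = P * Q"
    using qvar_nonzero unfolding P_def Q_def R_def S_def
    by (simp_all add: algebra_simps flip: power_int_add)
  show ?thesis
    unfolding gamma_coeff_def comm_coeff_def 1
    unfolding P_def[symmetric] Q_def[symmetric] R_def[symmetric] S_def[symmetric] C_def[symmetric] g_def[symmetric]
    by (simp add: algebra_simps)
qed

text \<open>The induction keeps b and d arbitrary, since multiplication by p_k calls for the
  hypothesis at (b, d + k) and (b + k, d) as well. Both shifts lead to the same operator, with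
  second index b + d + k.\<close>

lemma commutator:
  assumes "a + c \<noteq> 0" "F \<in> PS"
  shows "D c d (D a b F) - D a b (D c d F) = mps_const (comm_coeff a b c d) * D (a + c) (b + d) F"
  using assms(2)
proof (induction arbitrary: b d rule: PS.induct)
  case (PS_const e)
  have "D c d (D a b (mps_const e)) - D a b (D c d (mps_const e)) =
      mps_const e * (D c d (Omega_coeff a b) - D a b (Omega_coeff c d))"
    by (simp add: D_const D_cmult Omega_coeff_PS right_diff_distrib)
  thus ?case by (simp add: commutator_one[OF assms(1)] D_const mult_ac)
next
  case (PS_add F G)
  have "D c d (D a b (F + G)) - D a b (D c d (F + G)) =
    (D c d (D a b F) - D a b (D c d F)) + (D c d (D a b G) - D a b (D c d G))"
    using PS_add.hyps by (simp add: D_add D_PS)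
  also have "\<dots> = mps_const (comm_coeff a b c d) * (D (a + c) (b + d) F + D (a + c) (b + d) G)"
    by (simp only: PS_add.IH distrib_left)
  finally show ?case using PS_add.hyps by (simp add: D_add)
next
  case (PS_times k F)
  note IH = PS_times.IH
  have F: "D u v F \<in> PS" "F \<in> PS" for u v using PS_times by (auto intro: D_PS)
  have exp: "D u' v' (D u v (power_sum k * F)) = power_sum k * D u' v' (D u v F)
     + mps_const (gamma_coeff k u') * D u' (v' + int k) (D u v F) + mps_const (gamma_coeff k u)
         * D u' v' (D u (v + int k) F)" for u v u' v'
    using F PS_times(1)
    by (simp add: D_power_sum_times D_add D_cmult PS_cmult PS.PS_times)
  have "D c d (D a b (power_sum k * F)) - D a b (D c d (power_sum k * F)) =
    power_sum k * (D c d (D a b F) - D a b (D c d F)) +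
    mps_const (gamma_coeff k c) * (D c (d + int k) (D a b F) - D a b (D c (d + int k) F)) +
    mps_const (gamma_coeff k a) * (D c d (D a (b + int k) F) - D a (b + int k) (D c d F))"
    unfolding exp by (simp add: algebra_simps)
  also have "\<dots> = power_sum k * (mps_const (comm_coeff a b c d) * D (a + c) (b + d) F) +
    mps_const (gamma_coeff k c * comm_coeff a b c (d + int k) + gamma_coeff k a * comm_coeff a (b
        + int k) c d) * D (a + c) (b + d + int k) F"
    unfolding IH by (simp add: mps_const_add mps_const_mult algebra_simps)
  also have "\<dots> = mps_const (comm_coeff a b c d) * D (a + c) (b + d) (power_sum k * F)"
    unfolding comm_coeff_rec[OF assms(1)] D_power_sum_times[OF F(2) PS_times(1)]
    by (simp add: mps_const_mult algebra_simps)
  finally show ?case .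
qed

theorem theorem1p1:
  fixes a b c d u v :: int
  assumes "u = a + c" and "v = b + d"
    and "a \<noteq> 0" and "c \<noteq> 0" and "u \<noteq> 0"
  shows "\<forall>F \<in> Sym.
    mps_const (1 / Mq) * (D c d (D a b F) - D a b (D c d F)) =
    mps_const (qvar powi (1 + b * c)
               * (qint qvar a * qint qvar c / qint qvar u)
               * ((1 - qvar powi (d * a - b * c)) / (1 - qvar))) * D u v F"
proof
  fix F assume "F \<in> Sym"
  hence F: "F \<in> PS" using Sym_subset_PS by blast
  have const: "1 / Mq * comm_coeff a b c d = qvar powi (1 + b * c)
               * (qint qvar a * qint qvar c / qint qvar u)
               * ((1 - qvar powi (d * a - b * c)) / (1 - qvar))"
  proof -
    define q where "q = qvar"
    have q: "q \<noteq> 0" "1 - q \<noteq> 0" "1 - q powi u \<noteq> 0"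
      using qvar_nonzero qvar_power_int_neq_1[of 1] qvar_power_int_neq_1[OF assms(5)] by (auto simp: q_def)
    \<comment> \<open>The factor -q extracted here matches the one in 1/M = -q/(1 - q)^2.\<close>
    have 1: "q powi (1 + b * c) * (1 - q powi (d * a - b * c)) = - q * (q powi (a * d) - q powi (b * c))"
      using q by (simp add: power_int_add power_int_diff field_simps)
    have Mq_eq: "Mq = - ((1 - q) * (1 - q)) / q"
      using q by (simp add: Mq_def tvar_def field_simps flip: q_def)
    have Mq: "1 / Mq = - q / ((1 - q) * (1 - q))"
      unfolding Mq_eq by (simp add: divide_divide_eq_right)
    have "q powi (1 + b * c) * (qint q a * qint q c / qint q u) * ((1 - q powi (d * a - b
        * c)) / (1 - q)) =
      (q powi (1 + b * c) * (1 - q powi (d * a - b * c))) * ((1 - q powi a)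
          * (1 - q powi c) / (1 - q powi u)) / ((1 - q) * (1 - q))"
    proof -
      have "P * (A / m * (C / m) / (U / m)) * (E / m) = (P * E) * (A * C / U) / (m * m)"
        if "m \<noteq> 0" for P A C U E m :: qrat
        using that by (cases "U = 0") (simp_all add: field_simps)
      thus ?thesis unfolding qint_def using q(2) by blast
    qed
    also have "\<dots> = 1 / Mq * comm_coeff a b c d"
      unfolding 1 Mq comm_coeff_def assms(1) q_def[symmetric] by (simp add: mult_ac)
    finally show ?thesis by (simp add: q_def)
  qed
  have "a + c \<noteq> 0" using assms by simp
  from commutator[OF this F, of d b] assms(1,2)
  show "mps_const (1 / Mq) * (D c d (D a b F) - D a b (D c d F)) =
    mps_const (qvar powi (1 + b * c)
               * (qint qvar a * qint qvar c / qint qvar u)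
               * ((1 - qvar powi (d * a - b * c)) / (1 - qvar))) * D u v F"
    unfolding const[symmetric] mps_const_mult[of "1 / Mq"] by (simp add: mult.assoc)
qed

end
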